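(* Let $A$ be a semilattice of groups and $G$ a group. Equivalent admissible extensions of $A$ by $G$ define the same abstract kernel $\psi:G\to\varsigma(A)$.
   Context: Conventions. A semilattice of groups is an inverse semigroup whose idempotents are central. Ideals are two-sided. $E(S)$ is the set of idempotents of a semigroup $S$. Multipliers. A multiplier of a semigroup $S$ is a pair $m$ of maps $s\mapsto ms$, $s\mapsto sm$ from $S$ to $S$ with $m(st)=(ms)t$, $(st)m=s(tm)$, $s(mt)=(sm)t$ for all $s,t\in S$. They form a monoid $\mathcal M(S)$ with $(mn)s=m(ns)$, $s(mn)=(sm)n$. $\mathcal U(M)$ is the group of invertible elements of a monoid $M$. If $S^2=S$ (e.g. $S$ inverse, or an ideal of an inverse semigroup) then $(ms)n=m(sn)$, so $msn$ is unambiguous. The monoid $\varsigma(A)$. $\Sigma(A)$ is the inverse monoid (under composition of partial maps) of all isomorphisms between ideals of $A$. For $\varphi,\psi\in\Sigma(A)$ put $\psi\sim\varphi$ iff $\operatorname{dom}\varphi=\operatorname{dom}\psi$, $\operatorname{ran}\varphi=\operatorname{ran}\psi$ and there is $m\in\mathcal U(\mathcal M(\operatorname{ran}\varphi))$ with $\psi(s)=m\varphi(s)m^{-1}$ for all $s\in\operatorname{dom}\varphi$. This is a congruence and $\varsigma(A)=\Sigma(A)/{\sim}$. Extensions. An extension of $A$ by an inverse semigroup $S$ is an inverse semigroup $U$ with a monomorphism $i:A\to U$ and an idempotent-separating epimorphism $\pi:U\to S$ such that $i(A)=\pi^{-1}(E(S))$. An extension $A\xrightarrow{i}U\xrightarrow{j}G$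 of $A$ by the group $G$ is an inverse semigroup $U$ with a monomorphism $i$ and an epimorphism $j:U\to G$ such that $i(A)=j^{-1}(1)$. Two extensions $A\xrightarrow{i}U\xrightarrow{j}G$ and $A\xrightarrow{i'}U'\xrightarrow{j'}G$ are equivalent if there is an isomorphism $\mu:U\to U'$ with $\mu\circ i=i'$ and $j'\circ\mu=j$. A refinement of $A\xrightarrow{i}U\xrightarrow{j}G$ is $A\xrightarrow{i}U\xrightarrow{\pi}S\xrightarrow{\kappa}G$ with $S$ an $E$-unitary inverse semigroup, $A\xrightarrow{i}U\xrightarrow{\pi}S$ an extension of $A$ by $S$, $\kappa$ an epimorphism and $j=\kappa\circ\pi$. The extension is admissible if it has a refinement for which there is an order-preserving transversal of $\pi$: a map $\rho:S\to U$ with $\pi\circ\rho=\mathrm{id}_S$, $\rho(E(S))\subseteq E(U)$, preserving the natural partial orders. Given a refinement $A\xrightarrow{i}U\xrightarrow{\pi}S\xrightarrow{\kappa}G$ and an order-preserving transversal $\rho:S\to U$ of $\pi$, put $\mathcal D_g=\{a\in A:\exists s\in S,\ \kappa(s)=g,\ \rho(ss^{-1})=i(aa^{-1})\}$ and $\theta_g:\mathcal D_{g^{-1}}\to\mathcal D_g$, $\theta_g(a)=i^{-1}(\rho(s)i(a)\rho(s)^{-1})$, where $s$ is the element with $\kappa(s)=g$ and $\rho(s^{-1}s)=i(aa^{-1})$. The abstract kernel of the admissible extension $A\xrightarrow{i}U\xrightarrow{j}G$ is the map $\psi:G\to\varsigma(A)$, $g\mapsto[\theta_g]$, where $[\theta_g]$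 is the $\sim$-class of the isomorphism $\theta_g:\mathcal D_{g^{-1}}\to\mathcal D_g$, $\theta_g(a)=i^{-1}(\rho(s)i(a)\rho(s)^{-1})$ (with $s\in S$ the element satisfying $\kappa(s)=g$ and $\rho(s^{-1}s)=i(aa^{-1})$), computed from any refinement $A\xrightarrow{i}U\xrightarrow{\pi}S\xrightarrow{\kappa}G$ of the extension and any order-preserving transversal $\rho:S\to U$ of $\pi$. *)

theory Defs
  imports "HOL-Algebra.Group"
begin

text \<open>Semigroups are carried by the record type of monoids, so that the library's homomorphisms,
isomorphisms and products can be used; the field \<open>one\<close> of a record that is only assumed to be a
semigroup is never referred to.\<close>

section \<open>Inverse semigroups\<close>

locale inverse_semigroup =
  fixes S (structure)
  assumes nonempty: "carrier S \<noteq> {}"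
    and m_closed: "x \<in> carrier S \<Longrightarrow> y \<in> carrier S \<Longrightarrow> x \<otimes> y \<in> carrier S"
    and m_assoc: "x \<in> carrier S \<Longrightarrow> y \<in> carrier S \<Longrightarrow> z \<in> carrier S
      \<Longrightarrow> (x \<otimes> y) \<otimes> z = x \<otimes> (y \<otimes> z)"
    and ex1_inverse: "x \<in> carrier S
      \<Longrightarrow> \<exists>!y. y \<in> carrier S \<and> x \<otimes> y \<otimes> x = x \<and> y \<otimes> x \<otimes> y = y"

text \<open>The inverse in the sense of inverse semigroups; the library's \<open>m_inv\<close> is the inverse with
respect to \<open>one\<close>.\<close>

definition sinv :: "('a, 'x) monoid_scheme \<Rightarrow> 'a \<Rightarrow> 'a" where
  "sinv S x = (THE y. y \<in> carrier S \<and> x \<otimes>\<^bsub>S\<^esub> y \<otimes>\<^bsub>S\<^esub> x = x \<and> y \<otimes>\<^bsub>S\<^esub> x \<otimes>\<^bsub>S\<^esub> y = y)"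

definition idempotents :: "('a, 'x) monoid_scheme \<Rightarrow> 'a set" where
  "idempotents S = {e \<in> carrier S. e \<otimes>\<^bsub>S\<^esub> e = e}"

definition natural_le :: "('a, 'x) monoid_scheme \<Rightarrow> 'a \<Rightarrow> 'a \<Rightarrow> bool" where
  "natural_le S x y \<longleftrightarrow> (\<exists>e \<in> idempotents S. x = e \<otimes>\<^bsub>S\<^esub> y)"

locale semilattice_of_groups = inverse_semigroup +
  assumes idempotents_central:
    "e \<in> idempotents S \<Longrightarrow> x \<in> carrier S \<Longrightarrow> e \<otimes> x = x \<otimes> e"

locale E_unitary_inverse_semigroup = inverse_semigroup +
  assumes E_unitary:
    "e \<in> idempotents S \<Longrightarrow> x \<in> carrier S \<Longrightarrow> natural_le S e x \<Longrightarrow> x \<in> idempotents S"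

definition semigroup_ideal :: "('a, 'x) monoid_scheme \<Rightarrow> 'a set \<Rightarrow> bool" where
  "semigroup_ideal S I \<longleftrightarrow> I \<subseteq> carrier S \<and> I \<noteq> {} \<and>
    (\<forall>x \<in> I. \<forall>s \<in> carrier S. s \<otimes>\<^bsub>S\<^esub> x \<in> I \<and> x \<otimes>\<^bsub>S\<^esub> s \<in> I)"


section \<open>Multipliers\<close>

text \<open>A multiplier \<open>m\<close> is the pair \<open>(l, r)\<close> of the maps \<open>s \<mapsto> ms\<close> and \<open>s \<mapsto> sm\<close>, which are
\<open>undefined\<close> outside the carrier so that equality of pairs is equality of multipliers. In the
second component products compose in the opposite order, since \<open>s(mn) = (sm)n\<close>.\<close>

definition multiplier_monoid :: "('a, 'x) monoid_scheme \<Rightarrow> (('a \<Rightarrow> 'a) \<times> ('a \<Rightarrow> 'a)) monoid" where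
  "multiplier_monoid S =
    \<lparr>carrier = {(l, r).
        l \<in> carrier S \<rightarrow>\<^sub>E carrier S \<and> r \<in> carrier S \<rightarrow>\<^sub>E carrier S \<and>
        (\<forall>s \<in> carrier S. \<forall>t \<in> carrier S.
          l (s \<otimes>\<^bsub>S\<^esub> t) = l s \<otimes>\<^bsub>S\<^esub> t \<and>
          r (s \<otimes>\<^bsub>S\<^esub> t) = s \<otimes>\<^bsub>S\<^esub> r t \<and>
          s \<otimes>\<^bsub>S\<^esub> l t = r s \<otimes>\<^bsub>S\<^esub> t)},
     mult = (\<lambda>(l, r) (l', r'). (compose (carrier S) l l', compose (carrier S) r' r)),
     one = (\<lambda>s \<in> carrier S. s, \<lambda>s \<in> carrier S. s)\<rparr>"

text \<open>\<open>two_sided m s n\<close> is \<open>(ms)n\<close>.\<close>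

definition two_sided ::
    "('a \<Rightarrow> 'a) \<times> ('a \<Rightarrow> 'a) \<Rightarrow> 'a \<Rightarrow> ('a \<Rightarrow> 'a) \<times> ('a \<Rightarrow> 'a) \<Rightarrow> 'a" where
  "two_sided m s n = snd n (fst m s)"


section \<open>The monoids \<open>\<Sigma>(A)\<close> and \<open>\<varsigma>(A)\<close>\<close>

definition Sigma_monoid :: "('a, 'x) monoid_scheme \<Rightarrow> ('a \<rightharpoonup> 'a) monoid" where
  "Sigma_monoid A =
    \<lparr>carrier = {\<phi>. semigroup_ideal A (dom \<phi>) \<and> semigroup_ideal A (ran \<phi>) \<and>
        (\<lambda>s. the (\<phi> s)) \<in> iso (A\<lparr>carrier := dom \<phi>\<rparr>) (A\<lparr>carrier := ran \<phi>\<rparr>)},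
     mult = (\<circ>\<^sub>m),
     one = (\<lambda>s. if s \<in> carrier A then Some s else None)\<rparr>"

definition Sigma_cong :: "('a, 'x) monoid_scheme \<Rightarrow> (('a \<rightharpoonup> 'a) \<times> ('a \<rightharpoonup> 'a)) set" where
  "Sigma_cong A =
    {(\<phi>, \<psi>). \<phi> \<in> carrier (Sigma_monoid A) \<and> \<psi> \<in> carrier (Sigma_monoid A) \<and>
      dom \<phi> = dom \<psi> \<and> ran \<phi> = ran \<psi> \<and>
      (let M = multiplier_monoid (A\<lparr>carrier := ran \<phi>\<rparr>) in
        \<exists>m \<in> Units M. \<forall>s \<in> dom \<phi>. the (\<psi> s) = two_sided m (the (\<phi> s)) (inv\<^bsub>M\<^esub> m))}"

definition varsigma_monoid :: "('a, 'x) monoid_scheme \<Rightarrow> ('a \<rightharpoonup> 'a) set monoid" where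
  "varsigma_monoid A =
    \<lparr>carrier = carrier (Sigma_monoid A) // Sigma_cong A,
     mult = (\<lambda>X Y. \<Union>\<phi> \<in> X. \<Union>\<psi> \<in> Y. Sigma_cong A `` {\<phi> \<otimes>\<^bsub>Sigma_monoid A\<^esub> \<psi>}),
     one = Sigma_cong A `` {\<one>\<^bsub>Sigma_monoid A\<^esub>}\<rparr>"


section \<open>Extensions\<close>

definition extension_by_inverse_semigroup ::
    "'a monoid \<Rightarrow> 's monoid \<Rightarrow> 'u monoid \<Rightarrow> ('a \<Rightarrow> 'u) \<Rightarrow> ('u \<Rightarrow> 's) \<Rightarrow> bool" where
  "extension_by_inverse_semigroup A S U i \<pi> \<longleftrightarrow>
    inverse_semigroup S \<and> inverse_semigroup U \<and> i \<in> mon A U \<and> \<pi> \<in> epi U S \<and>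
    inj_on \<pi> (idempotents U) \<and>
    i ` carrier A = {u \<in> carrier U. \<pi> u \<in> idempotents S}"

definition extension_by_group ::
    "'a monoid \<Rightarrow> 'g monoid \<Rightarrow> 'u monoid \<Rightarrow> ('a \<Rightarrow> 'u) \<Rightarrow> ('u \<Rightarrow> 'g) \<Rightarrow> bool" where
  "extension_by_group A G U i j \<longleftrightarrow>
    inverse_semigroup U \<and> i \<in> mon A U \<and> j \<in> epi U G \<and>
    i ` carrier A = {u \<in> carrier U. j u = \<one>\<^bsub>G\<^esub>}"

definition equivalent_extensions ::
    "'a monoid \<Rightarrow> 'u monoid \<Rightarrow> ('a \<Rightarrow> 'u) \<Rightarrow> ('u \<Rightarrow> 'g)
      \<Rightarrow> 'v monoid \<Rightarrow> ('a \<Rightarrow> 'v) \<Rightarrow> ('v \<Rightarrow> 'g) \<Rightarrow> bool" where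
  "equivalent_extensions A U i j U' i' j' \<longleftrightarrow>
    (\<exists>\<mu> \<in> iso U U'. (\<forall>a \<in> carrier A. \<mu> (i a) = i' a) \<and> (\<forall>u \<in> carrier U. j' (\<mu> u) = j u))"

definition refinement ::
    "'a monoid \<Rightarrow> 'g monoid \<Rightarrow> 'u monoid \<Rightarrow> ('a \<Rightarrow> 'u) \<Rightarrow> ('u \<Rightarrow> 'g)
      \<Rightarrow> 's monoid \<Rightarrow> ('u \<Rightarrow> 's) \<Rightarrow> ('s \<Rightarrow> 'g) \<Rightarrow> bool" where
  "refinement A G U i j S \<pi> \<kappa> \<longleftrightarrow>
    E_unitary_inverse_semigroup S \<and> extension_by_inverse_semigroup A S U i \<pi> \<and>
    \<kappa> \<in> epi S G \<and> (\<forall>u \<in> carrier U. j u = \<kappa> (\<pi> u))"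

definition order_preserving_transversal ::
    "'u monoid \<Rightarrow> 's monoid \<Rightarrow> ('u \<Rightarrow> 's) \<Rightarrow> ('s \<Rightarrow> 'u) \<Rightarrow> bool" where
  "order_preserving_transversal U S \<pi> \<rho> \<longleftrightarrow>
    \<rho> \<in> carrier S \<rightarrow> carrier U \<and> (\<forall>s \<in> carrier S. \<pi> (\<rho> s) = s) \<and>
    \<rho> ` idempotents S \<subseteq> idempotents U \<and>
    (\<forall>s \<in> carrier S. \<forall>t \<in> carrier S. natural_le S s t \<longrightarrow> natural_le U (\<rho> s) (\<rho> t))"

text \<open>HOL cannot quantify over the type of the elements of \<open>S\<close> inside a formula, so this type is
an explicit parameter of the notions depending on refinements.\<close>

definition admissible ::
    "'s itself \<Rightarrow> 'a monoid \<Rightarrow> 'g monoid \<Rightarrow> 'u monoid \<Rightarrow> ('a \<Rightarrow> 'u) \<Rightarrow> ('u \<Rightarrow> 'g) \<Rightarrow> bool" where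
  "admissible T A G U i j \<longleftrightarrow>
    extension_by_group A G U i j \<and>
    (\<exists>(S :: 's monoid) \<pi> \<kappa> \<rho>.
      refinement A G U i j S \<pi> \<kappa> \<and> order_preserving_transversal U S \<pi> \<rho>)"


section \<open>The abstract kernel\<close>

definition kernel_dom ::
    "'a monoid \<Rightarrow> 'u monoid \<Rightarrow> ('a \<Rightarrow> 'u) \<Rightarrow> 's monoid \<Rightarrow> ('s \<Rightarrow> 'g) \<Rightarrow> ('s \<Rightarrow> 'u)
      \<Rightarrow> 'g \<Rightarrow> 'a set" where
  "kernel_dom A U i S \<kappa> \<rho> g =
    {a \<in> carrier A. \<exists>s \<in> carrier S. \<kappa> s = g \<and>
      \<rho> (s \<otimes>\<^bsub>S\<^esub> sinv S s) = i (a \<otimes>\<^bsub>A\<^esub> sinv A a)}"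

definition kernel_iso ::
    "'a monoid \<Rightarrow> 'g monoid \<Rightarrow> 'u monoid \<Rightarrow> ('a \<Rightarrow> 'u) \<Rightarrow> 's monoid \<Rightarrow> ('s \<Rightarrow> 'g) \<Rightarrow> ('s \<Rightarrow> 'u)
      \<Rightarrow> 'g \<Rightarrow> ('a \<rightharpoonup> 'a)" where
  "kernel_iso A G U i S \<kappa> \<rho> g = (\<lambda>a.
    if a \<in> kernel_dom A U i S \<kappa> \<rho> (inv\<^bsub>G\<^esub> g)
    then let s = (THE s. s \<in> carrier S \<and> \<kappa> s = g \<and>
                    \<rho> (sinv S s \<otimes>\<^bsub>S\<^esub> s) = i (a \<otimes>\<^bsub>A\<^esub> sinv A a))
      in Some (inv_into (carrier A) i (\<rho> s \<otimes>\<^bsub>U\<^esub> i a \<otimes>\<^bsub>U\<^esub> sinv U (\<rho> s)))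
    else None)"

definition kernel_map ::
    "'a monoid \<Rightarrow> 'g monoid \<Rightarrow> 'u monoid \<Rightarrow> ('a \<Rightarrow> 'u) \<Rightarrow> 's monoid \<Rightarrow> ('s \<Rightarrow> 'g) \<Rightarrow> ('s \<Rightarrow> 'u)
      \<Rightarrow> 'g \<Rightarrow> ('a \<rightharpoonup> 'a) set" where
  "kernel_map A G U i S \<kappa> \<rho> = (\<lambda>g \<in> carrier G. Sigma_cong A `` {kernel_iso A G U i S \<kappa> \<rho> g})"

text \<open>\<open>\<psi>\<close> is the abstract kernel if it is a map into \<open>\<varsigma>(A)\<close> which is obtained from every refinement
and every order-preserving transversal. For an admissible extension there is at most one
such \<open>\<psi>\<close>; that there is one is not built into the definition.\<close>

definition is_abstract_kernel ::
    "'s itself \<Rightarrow> 'a monoid \<Rightarrow> 'g monoid \<Rightarrow> 'u monoid \<Rightarrow> ('a \<Rightarrow> 'u) \<Rightarrow> ('u \<Rightarrow> 'g)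
      \<Rightarrow> ('g \<Rightarrow> ('a \<rightharpoonup> 'a) set) \<Rightarrow> bool" where
  "is_abstract_kernel T A G U i j \<psi> \<longleftrightarrow>
    \<psi> \<in> carrier G \<rightarrow>\<^sub>E carrier (varsigma_monoid A) \<and>
    (\<forall>(S :: 's monoid) \<pi> \<kappa> \<rho>.
      refinement A G U i j S \<pi> \<kappa> \<and> order_preserving_transversal U S \<pi> \<rho>
      \<longrightarrow> \<psi> = kernel_map A G U i S \<kappa> \<rho>)"

lemma is_abstract_kernel_unique:
  assumes "admissible T A G U i j"
    and "is_abstract_kernel T A G U i j \<psi>" and "is_abstract_kernel T A G U i j \<psi>'"
  shows "\<psi> = \<psi>'"
  using assms unfolding admissible_def is_abstract_kernel_def by blast

end

theory Submission
  imports Defs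
begin

text \<open>The map \<open>\<pi>\<close> separates idempotents and \<open>\<kappa>\<^sup>-\<^sup>1(1) = E(S)\<close>, so the domains of the isomorphisms \<open>\<theta>\<^sub>g\<close>
can be described without \<open>S\<close>: \<open>\<D>\<^sub>g\<close> consists of the \<open>a\<close> with \<open>i(aa\<^sup>-\<^sup>1) = uu\<^sup>-\<^sup>1\<close> for some \<open>u \<in> U\<close> over \<open>g\<close>.
An order-preserving transversal only enters through a compatible choice of an element \<open>w(e)\<close> over
\<open>g\<close> with \<open>w(e)\<^sup>-\<^sup>1w(e) = i(e)\<close> for the idempotents \<open>e\<close> of \<open>\<D>\<close> at \<open>g\<^sup>-\<^sup>1\<close>, and such choices are
transported by equivalences of extensions. Two choices \<open>w\<close>, \<open>w'\<close> in the same \<open>U\<close> differ by the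
elements \<open>w'(e)w(e)\<^sup>-\<^sup>1\<close> of maximal subgroups of \<open>i(A)\<close>; these fit together to an invertible multiplier
of \<open>\<D>\<^sub>g\<close> which conjugates one isomorphism into the other.\<close>

section \<open>Inverse semigroups\<close>

text \<open>Every \<open>u\<close> has a source \<open>u^-1 u\<close> and a range
  \<open>u u^-1\<close>. The engine is that \<open>i(A)\<close> is the whole fibre of
  \<open>j\<close> over the unit: for \<open>u\<close>, \<open>v\<close> over the same
  \<open>g\<close> both \<open>u^-1 v\<close> and \<open>u v^-1\<close> fall into
  \<open>i(A)\<close>, where source and range agree and idempotents are central, although
  \<open>U\<close> itself need have neither property. The equality \<kappa>^-1(1) = E(S) comes from
  two descriptions of one set: \<open>i(A)\<close> is \<pi>^-1(E(S)) and also j^-1(1) =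
  \<pi>^-1(\<kappa>^-1(1)), and \<pi> is onto. A multiplier has to replace a conjugating element
  because the ideal D_g need not have an identity, so a single element of \<open>A\<close> need not
  restrict to all the required group elements. The abstract kernel must be the same for all
  refinements and transversals, and this agreement is not granted by its definition. Independence of
  the choices is therefore proved together with invariance under equivalence: both follow from
  comparing an arbitrary kernel map of \<open>U\<close> with an arbitrary one of
  \<open>U'\<close>.\<close>

lemma idempotentsD:
  assumes "e \<in> idempotents S"
  shows "e \<in> carrier S" and "e \<otimes>\<^bsub>S\<^esub> e = e"
  using assms by (auto simp: idempotents_def)

section \<open>Inverses, idempotents and the natural order\<close>

context inverse_semigroup
begin

lemma sinv_closed [simp]: "x \<in> carrier S \<Longrightarrow> sinv S x \<in> carrier S"
  and mult_sinv_mult: "x \<in> carrier S \<Longrightarrow> x \<otimes> sinv S x \<otimes> x = x"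
  and sinv_mult_sinv: "x \<in> carrier S \<Longrightarrow> sinv S x \<otimes> x \<otimes> sinv S x = sinv S x"
  using theI'[OF ex1_inverse, of x] unfolding sinv_def by blast+

lemmas [simp] = m_closed m_assoc

lemma sinv_unique:
  assumes "x \<in> carrier S" "y \<in> carrier S" "x \<otimes> y \<otimes> x = x" "y \<otimes> x \<otimes> y = y"
  shows "sinv S x = y"
  unfolding sinv_def using assms by (intro the1_equality ex1_inverse) auto

lemma mult_sinv_cancel [simp]:
  assumes "x \<in> carrier S"
  shows "x \<otimes> (sinv S x \<otimes> x) = x" and "sinv S x \<otimes> (x \<otimes> sinv S x) = sinv S x"
  using mult_sinv_mult[OF assms] sinv_mult_sinv[OF assms] assms by simp_all

lemma mult_sinv_left_cancel [simp]:
  assumes "x \<in> carrier S" "y \<in> carrier S"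
  shows "x \<otimes> (sinv S x \<otimes> (x \<otimes> y)) = x \<otimes> y"
    and "sinv S x \<otimes> (x \<otimes> (sinv S x \<otimes> y)) = sinv S x \<otimes> y"
  using mult_sinv_mult[OF assms(1)] sinv_mult_sinv[OF assms(1)] assms
  by (metis m_assoc m_closed sinv_closed)+

lemma sinv_sinv [simp]: "x \<in> carrier S \<Longrightarrow> sinv S (sinv S x) = x"
  by (rule sinv_unique) simp_all

lemma idempotent_left_absorb [simp]:
  "e \<in> idempotents S \<Longrightarrow> x \<in> carrier S \<Longrightarrow> e \<otimes> (e \<otimes> x) = e \<otimes> x"
  by (metis idempotentsD m_assoc)

lemma sinv_idempotent [simp]: "e \<in> idempotents S \<Longrightarrow> sinv S e = e"
  by (rule sinv_unique) (simp_all add: idempotentsD)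

lemma idempotent_sinv_mult [simp]:
  "x \<in> carrier S \<Longrightarrow> sinv S x \<otimes> x \<in> idempotents S"
  "x \<in> carrier S \<Longrightarrow> x \<otimes> sinv S x \<in> idempotents S"
  by (simp_all add: idempotents_def)

text \<open>For the inverse \<open>x\<close> of \<open>ef\<close>, the element \<open>f x e\<close>
  is another inverse of \<open>ef\<close>, so uniqueness gives \<open>x = f x e\<close>. Then
  \<open>x e f x = x\<close> makes \<open>x\<close> idempotent, and an idempotent is its own
  inverse, so \<open>ef = x\<close>.\<close>

lemma idempotents_mult_closed [simp]:
  assumes "e \<in> idempotents S" "f \<in> idempotents S"
  shows "e \<otimes> f \<in> idempotents S"
proof -
  note [simp] = idempotentsD[OF assms(1)] idempotentsD[OF assms(2)] assms
  define x where "x = sinv S (e \<otimes> f)"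
  have xc [simp]: "x \<in> carrier S" by (simp add: x_def)
  have ef: "e \<otimes> f \<otimes> x \<otimes> (e \<otimes> f) = e \<otimes> f" "x \<otimes> (e \<otimes> f) \<otimes> x = x"
    unfolding x_def by (intro mult_sinv_mult sinv_mult_sinv; simp)+
  have x_ef_x: "x \<otimes> (e \<otimes> (f \<otimes> (x \<otimes> y))) = x \<otimes> y" if "y \<in> carrier S" for y
    using ef(2) that by (metis m_assoc m_closed xc idempotentsD(1) assms)
  have "sinv S (e \<otimes> f) = f \<otimes> x \<otimes> e"
    using ef by (intro sinv_unique) (simp_all add: x_ef_x)
  then have x_eq: "f \<otimes> (x \<otimes> e) = x"
    by (simp add: x_def)
  have "x \<otimes> x = (f \<otimes> (x \<otimes> e)) \<otimes> (f \<otimes> (x \<otimes> e))"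
    by (simp only: x_eq)
  also have "\<dots> = f \<otimes> (x \<otimes> e)"
    by (simp add: x_ef_x)
  finally have "x \<in> idempotents S"
    by (simp add: x_eq idempotents_def)
  then have "sinv S x = x" by simp
  then have "e \<otimes> f = x" unfolding x_def by simp
  with \<open>x \<in> idempotents S\<close> show ?thesis by simp
qed

text \<open>Both products are idempotent, so \<open>fe\<close> satisfies the equations of an inverse
  of \<open>ef\<close>, which is its own inverse.\<close>

lemma idempotents_commute:
  assumes "e \<in> idempotents S" "f \<in> idempotents S"
  shows "e \<otimes> f = f \<otimes> e"
proof -
  note [simp] = idempotentsD[OF assms(1)] idempotentsD[OF assms(2)] assms
  have "e \<otimes> f \<otimes> (e \<otimes> f) = e \<otimes> f" "f \<otimes> e \<otimes> (f \<otimes> e) = f \<otimes> e"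
    using assms idempotents_mult_closed idempotentsD(2) by metis+
  then have "sinv S (e \<otimes> f) = f \<otimes> e"
    by (intro sinv_unique) simp_all
  then show ?thesis by simp
qed

lemma sinv_mult:
  assumes [simp]: "x \<in> carrier S" "y \<in> carrier S"
  shows "sinv S (x \<otimes> y) = sinv S y \<otimes> sinv S x"
proof (rule sinv_unique)
  have comm: "sinv S x \<otimes> x \<otimes> (y \<otimes> sinv S y) = y \<otimes> sinv S y \<otimes> (sinv S x \<otimes> x)"
    by (intro idempotents_commute) simp_all
  have "x \<otimes> y \<otimes> (sinv S y \<otimes> sinv S x) \<otimes> (x \<otimes> y)
      = x \<otimes> (y \<otimes> sinv S y \<otimes> (sinv S x \<otimes> x)) \<otimes> y" by simp
  also have "\<dots> = x \<otimes> y" unfolding comm[symmetric] by simp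
  finally show "x \<otimes> y \<otimes> (sinv S y \<otimes> sinv S x) \<otimes> (x \<otimes> y) = x \<otimes> y" .
  have "sinv S y \<otimes> sinv S x \<otimes> (x \<otimes> y) \<otimes> (sinv S y \<otimes> sinv S x)
      = sinv S y \<otimes> (sinv S x \<otimes> x \<otimes> (y \<otimes> sinv S y)) \<otimes> sinv S x" by simp
  also have "\<dots> = sinv S y \<otimes> sinv S x" unfolding comm by simp
  finally show "sinv S y \<otimes> sinv S x \<otimes> (x \<otimes> y) \<otimes> (sinv S y \<otimes> sinv S x) = sinv S y \<otimes> sinv S x" .
qed simp_all

lemma idempotent_conj [simp]:
  assumes "e \<in> idempotents S" and [simp]: "x \<in> carrier S"
  shows "x \<otimes> (e \<otimes> sinv S x) \<in> idempotents S"
proof -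
  note [simp] = idempotentsD[OF assms(1)] assms(1)
  have "x \<otimes> (e \<otimes> sinv S x) = (x \<otimes> e) \<otimes> sinv S (x \<otimes> e)"
    by (simp add: sinv_mult)
  then show ?thesis
    by (metis idempotent_sinv_mult(2) m_closed idempotentsD(1) assms)
qed

lemma idempotent_conj' [simp]:
  assumes "e \<in> idempotents S" "x \<in> carrier S"
  shows "sinv S x \<otimes> (e \<otimes> x) \<in> idempotents S"
  using idempotent_conj[of e "sinv S x"] assms by simp

text \<open>Idempotents need not be central; moving one across \<open>x\<close> replaces it by its
  conjugate. A restriction at the range thereby becomes a restriction at the source.\<close>

lemma idempotent_mult_eq_mult_conj:
  assumes "e \<in> idempotents S" and [simp]: "x \<in> carrier S"
  shows "e \<otimes> x = x \<otimes> (sinv S x \<otimes> (e \<otimes> x))"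
proof -
  note [simp] = idempotentsD[OF assms(1)]
  have "e \<otimes> (x \<otimes> sinv S x) = x \<otimes> sinv S x \<otimes> e"
    using assms by (intro idempotents_commute) auto
  then have "e \<otimes> (x \<otimes> sinv S x) \<otimes> x = x \<otimes> sinv S x \<otimes> e \<otimes> x" by simp
  then show ?thesis by simp
qed

text \<open>The order is defined by an unspecified idempotent on the left, whereas sections are
  restricted on the right. With the source of the smaller element as the idempotent, the order
  becomes an equation.\<close>

lemma natural_le_iff_restrict:
  assumes [simp]: "x \<in> carrier S" "y \<in> carrier S"
  shows "natural_le S x y \<longleftrightarrow> x = y \<otimes> (sinv S x \<otimes> x)"
proof
  assume "natural_le S x y"
  then obtain e where e: "e \<in> idempotents S" "x = e \<otimes> y"
    unfolding natural_le_def by blast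
  note [simp] = idempotentsD[OF e(1)] e(1)
  show "x = y \<otimes> (sinv S x \<otimes> x)"
    using idempotent_mult_eq_mult_conj[OF e(1), of y] by (simp add: e sinv_mult)
next
  assume *: "x = y \<otimes> (sinv S x \<otimes> x)"
  have "sinv S (sinv S y) \<otimes> (sinv S x \<otimes> x) \<otimes> sinv S y \<in> idempotents S"
    using idempotent_conj'[of "sinv S x \<otimes> x" "sinv S y"] by simp
  moreover have "y \<otimes> (sinv S x \<otimes> x) \<otimes> sinv S y \<otimes> y = y \<otimes> (sinv S x \<otimes> x)"
  proof -
    have "sinv S x \<otimes> x \<otimes> (sinv S y \<otimes> y) = sinv S y \<otimes> y \<otimes> (sinv S x \<otimes> x)"
      by (intro idempotents_commute) simp_all
    then have "y \<otimes> (sinv S x \<otimes> x \<otimes> (sinv S y \<otimes> y)) = y \<otimes> (sinv S y \<otimes> y \<otimes> (sinv S x \<otimes> x))"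
      by simp
    then show ?thesis by simp
  qed
  ultimately show "natural_le S x y"
    unfolding natural_le_def using * by (intro bexI[of _ "y \<otimes> (sinv S x \<otimes> x) \<otimes> sinv S y"]) auto
qed

section \<open>Homomorphisms and inverses\<close>

lemma hom_sinv:
  assumes "inverse_semigroup T" "h \<in> hom S T" and [simp]: "x \<in> carrier S"
  shows "h (sinv S x) = sinv T (h x)"
proof -
  interpret T: inverse_semigroup T by fact
  show ?thesis
    using assms(2)
    by (intro T.sinv_unique[symmetric]) (simp_all add: hom_in_carrier flip: hom_mult[OF assms(2)])
qed

lemma group_hom_sinv:
  assumes "group G" "h \<in> hom S G" and [simp]: "x \<in> carrier S"
  shows "h (sinv S x) = inv\<^bsub>G\<^esub> (h x)"
proof -
  interpret G: group G by fact
  have *: "h x \<in> carrier G" "h (sinv S x) \<in> carrier G"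
    using assms hom_in_carrier by fastforce+
  have "h (x \<otimes> sinv S x \<otimes> x) = h x" by simp
  then have "h x \<otimes>\<^bsub>G\<^esub> h (sinv S x) \<otimes>\<^bsub>G\<^esub> h x = h x"
    using assms(2) by (simp add: hom_mult del: m_assoc mult_sinv_cancel)
  then have "h x \<otimes>\<^bsub>G\<^esub> h (sinv S x) = \<one>\<^bsub>G\<^esub>"
    using * G.right_cancel[of "h x" "h x \<otimes>\<^bsub>G\<^esub> h (sinv S x)" "\<one>\<^bsub>G\<^esub>"] by simp
  then show ?thesis using * by (metis G.inv_equality G.inv_inv G.inv_closed)
qed

end

lemma idempotents_hom:
  "h \<in> hom S T \<Longrightarrow> e \<in> idempotents S \<Longrightarrow> h e \<in> idempotents T"
  by (auto simp: idempotents_def hom_in_carrier simp flip: hom_mult)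

section \<open>Supports in a semilattice of groups\<close>

context semilattice_of_groups
begin

text \<open>By centrality \<open>x\<close> absorbs its source on the left and its range on the
  right; bracketing \<open>x^-1 x x x^-1\<close> in two ways gives the two sides. So every element
  sits in a maximal subgroup.\<close>

lemma sinv_mult_comm:
  assumes [simp]: "x \<in> carrier S"
  shows "sinv S x \<otimes> x = x \<otimes> sinv S x"
proof -
  have e: "sinv S x \<otimes> x \<otimes> x = x"
    using idempotents_central[of "sinv S x \<otimes> x" x] by simp
  have f: "x \<otimes> (x \<otimes> sinv S x) = x"
    using idempotents_central[of "x \<otimes> sinv S x" x] by simp
  have "sinv S x \<otimes> x = sinv S x \<otimes> (x \<otimes> (x \<otimes> sinv S x))"
    by (simp only: f)
  also have "\<dots> = sinv S x \<otimes> x \<otimes> x \<otimes> sinv S x" by simp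
  also have "\<dots> = x \<otimes> sinv S x" by (simp only: e)
  finally show ?thesis .
qed

text \<open>Centrality lets \<open>y y^-1\<close> pass \<open>x^-1\<close>. Multiplicativity of
  supports is what allows families of conjugating elements to be indexed by idempotents.\<close>

lemma mult_sinv_of_mult:
  assumes [simp]: "x \<in> carrier S" "y \<in> carrier S"
  shows "x \<otimes> y \<otimes> sinv S (x \<otimes> y) = x \<otimes> sinv S x \<otimes> (y \<otimes> sinv S y)"
  using idempotents_central[of "y \<otimes> sinv S y" "sinv S x"] by (simp add: sinv_mult)

end

section \<open>Conjugation by multipliers\<close>

lemma semigroup_ideal_absorb:
  assumes "semigroup_ideal S I" "x \<in> I"
  shows "x \<in> carrier S" and "s \<in> carrier S \<Longrightarrow> s \<otimes>\<^bsub>S\<^esub> x \<in> I" and "s \<in> carrier S \<Longrightarrow> x \<otimes>\<^bsub>S\<^esub> s \<in> I"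
  using assms by (auto simp: semigroup_ideal_def)

lemma multiplier_monoid_simps [simp]:
  "(l, r) \<otimes>\<^bsub>multiplier_monoid S\<^esub> (l', r') = (compose (carrier S) l l', compose (carrier S) r' r)"
  "\<one>\<^bsub>multiplier_monoid S\<^esub> = (\<lambda>s \<in> carrier S. s, \<lambda>s \<in> carrier S. s)"
  by (simp_all add: multiplier_monoid_def)

lemma in_multiplier_monoid_iff:
  "(l, r) \<in> carrier (multiplier_monoid S) \<longleftrightarrow>
    l \<in> carrier S \<rightarrow>\<^sub>E carrier S \<and> r \<in> carrier S \<rightarrow>\<^sub>E carrier S \<and>
    (\<forall>s \<in> carrier S. \<forall>t \<in> carrier S.
      l (s \<otimes>\<^bsub>S\<^esub> t) = l s \<otimes>\<^bsub>S\<^esub> t \<and> r (s \<otimes>\<^bsub>S\<^esub> t) = s \<otimes>\<^bsub>S\<^esub> r t \<and> s \<otimes>\<^bsub>S\<^esub> l t = r s \<otimes>\<^bsub>S\<^esub> t)"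
  by (simp add: multiplier_monoid_def)

lemma multiplierD:
  assumes "(l, r) \<in> carrier (multiplier_monoid S)" and "s \<in> carrier S"
  shows "l s \<in> carrier S" and "r s \<in> carrier S"
    and "t \<in> carrier S \<Longrightarrow> l (s \<otimes>\<^bsub>S\<^esub> t) = l s \<otimes>\<^bsub>S\<^esub> t"
    and "t \<in> carrier S \<Longrightarrow> r (s \<otimes>\<^bsub>S\<^esub> t) = s \<otimes>\<^bsub>S\<^esub> r t"
    and "t \<in> carrier S \<Longrightarrow> s \<otimes>\<^bsub>S\<^esub> l t = r s \<otimes>\<^bsub>S\<^esub> t"
  using assms by (auto simp: in_multiplier_monoid_iff)

lemma multiplier_monoid_is_monoid:
  assumes "\<And>x y. x \<in> carrier S \<Longrightarrow> y \<in> carrier S \<Longrightarrow> x \<otimes>\<^bsub>S\<^esub> y \<in> carrier S"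
  shows "monoid (multiplier_monoid S)"
proof -
  let ?M = "multiplier_monoid S"
  have hom: "l \<in> carrier S \<rightarrow> carrier S" "l \<in> extensional (carrier S)"
      "r \<in> carrier S \<rightarrow> carrier S" "r \<in> extensional (carrier S)"
    if "(l, r) \<in> carrier ?M" for l r
    using that by (auto simp: in_multiplier_monoid_iff PiE_def)
  show ?thesis
  proof (rule monoidI, unfold split_paired_all)
    fix l r l' r' assume m: "(l, r) \<in> carrier ?M" "(l', r') \<in> carrier ?M"
    show "(l, r) \<otimes>\<^bsub>?M\<^esub> (l', r') \<in> carrier ?M"
      unfolding multiplier_monoid_simps in_multiplier_monoid_iff
    proof (intro conjI ballI)
      show "compose (carrier S) l l' \<in> carrier S \<rightarrow>\<^sub>E carrier S"
        and "compose (carrier S) r' r \<in> carrier S \<rightarrow>\<^sub>E carrier S"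
        using hom[OF m(1)] hom[OF m(2)] by (auto simp: PiE_def compose_def)
      fix s t assume st: "s \<in> carrier S" "t \<in> carrier S"
      have mem: "l' s \<in> carrier S" "l' t \<in> carrier S" "r s \<in> carrier S" "r t \<in> carrier S"
        using m st by (blast intro: multiplierD)+
      show "compose (carrier S) l l' (s \<otimes>\<^bsub>S\<^esub> t) = compose (carrier S) l l' s \<otimes>\<^bsub>S\<^esub> t"
        using st mem by (simp add: compose_eq assms multiplierD(3)[OF m(1)] multiplierD(3)[OF m(2)])
      show "compose (carrier S) r' r (s \<otimes>\<^bsub>S\<^esub> t) = s \<otimes>\<^bsub>S\<^esub> compose (carrier S) r' r t"
        using st mem by (simp add: compose_eq assms multiplierD(4)[OF m(1)] multiplierD(4)[OF m(2)])
      show "s \<otimes>\<^bsub>S\<^esub> compose (carrier S) l l' t = compose (carrier S) r' r s \<otimes>\<^bsub>S\<^esub> t"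
        using st mem multiplierD(5)[OF m(1), of s "l' t"] multiplierD(5)[OF m(2), of "r s" t]
        by (simp add: compose_eq)
    qed
    show "(l, r) \<otimes>\<^bsub>?M\<^esub> (l', r') \<otimes>\<^bsub>?M\<^esub> (l'', r'') = (l, r) \<otimes>\<^bsub>?M\<^esub> ((l', r') \<otimes>\<^bsub>?M\<^esub> (l'', r''))"
      if "(l'', r'') \<in> carrier ?M" for l'' r''
      by (simp only: multiplier_monoid_simps compose_assoc[OF hom(1)[OF that]]
          compose_assoc[OF hom(3)[OF m(1)]])
  next
    show "\<one>\<^bsub>?M\<^esub> \<in> carrier ?M"
      by (auto simp: in_multiplier_monoid_iff assms)
  next
    fix l r assume "(l, r) \<in> carrier ?M"
    from hom[OF this] show "\<one>\<^bsub>?M\<^esub> \<otimes>\<^bsub>?M\<^esub> (l, r) = (l, r)" "(l, r) \<otimes>\<^bsub>?M\<^esub> \<one>\<^bsub>?M\<^esub> = (l, r)"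
      by (simp_all add: Id_compose compose_Id)
  qed
qed

lemma two_sided_one [simp]:
  "s \<in> carrier S \<Longrightarrow> two_sided \<one>\<^bsub>multiplier_monoid S\<^esub> s \<one>\<^bsub>multiplier_monoid S\<^esub> = s"
  by (simp add: two_sided_def)

text \<open>The point is that the left map of \<open>m\<close> commutes with the right map of
  \<open>n'\<close>. On a product \<open>t u\<close> the first acts on \<open>t\<close> only and the
  second on \<open>u\<close> only, and \<open>square\<close> writes every element as such a
  product.\<close>

lemma two_sided_mult:
  assumes "m \<in> carrier (multiplier_monoid S)" "m' \<in> carrier (multiplier_monoid S)"
    and "n \<in> carrier (multiplier_monoid S)" "n' \<in> carrier (multiplier_monoid S)"
    and "s \<in> carrier S"
    and square: "\<And>s. s \<in> carrier S \<Longrightarrow> \<exists>t \<in> carrier S. \<exists>u \<in> carrier S. s = t \<otimes>\<^bsub>S\<^esub> u"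
  shows "two_sided m (two_sided n s n') m'
    = two_sided (m \<otimes>\<^bsub>multiplier_monoid S\<^esub> n) s (n' \<otimes>\<^bsub>multiplier_monoid S\<^esub> m')"
proof -
  obtain l r l' r' p q p' q' where eq: "m = (l, r)" "m' = (l', r')" "n = (p, q)" "n' = (p', q')"
    by (cases m; cases m'; cases n; cases n')
  note mem = assms(1-4)[unfolded eq]
  have "l (q' x) = q' (l x)" if "x \<in> carrier S" for x
  proof -
    obtain t u where "t \<in> carrier S" "u \<in> carrier S" "x = t \<otimes>\<^bsub>S\<^esub> u"
      using square \<open>x \<in> carrier S\<close> by metis
    then show ?thesis
      by (simp add: multiplierD(1,3)[OF mem(1)] multiplierD(2,4)[OF mem(4)])
  qed
  then show ?thesis
    using assms(5)
    by (simp add: eq two_sided_def compose_eq multiplierD(1)[OF mem(1)] multiplierD(1)[OF mem(3)]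
        multiplierD(2)[OF mem(4)])
qed

lemma (in monoid) inv_mult_Units:
  assumes "x \<in> Units G" "y \<in> Units G"
  shows "inv (x \<otimes> y) = inv y \<otimes> inv x"
proof (rule inv_unique'[symmetric])
  have [simp]: "x \<in> carrier G" "y \<in> carrier G" using assms by auto
  have "x \<otimes> y \<otimes> (inv y \<otimes> inv x) = x \<otimes> (y \<otimes> inv y) \<otimes> inv x"
    using assms by (simp only: m_assoc m_closed Units_closed Units_inv_closed)
  then show "x \<otimes> y \<otimes> (inv y \<otimes> inv x) = \<one>" using assms by simp
  have "inv y \<otimes> inv x \<otimes> (x \<otimes> y) = inv y \<otimes> (inv x \<otimes> x) \<otimes> y"
    using assms by (simp only: m_assoc m_closed Units_closed Units_inv_closed)
  then show "inv y \<otimes> inv x \<otimes> (x \<otimes> y) = \<one>" using assms by simp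
qed (use assms in auto)

section \<open>Symmetry and transitivity of the congruence on the isomorphisms between
  ideals\<close>

lemma Sigma_monoidD:
  assumes "\<phi> \<in> carrier (Sigma_monoid A)"
  shows "semigroup_ideal A (dom \<phi>)" "semigroup_ideal A (ran \<phi>)"
  using assms by (simp_all add: Sigma_monoid_def)

lemma Sigma_cong_iff:
  "(\<phi>, \<psi>) \<in> Sigma_cong A \<longleftrightarrow>
    \<phi> \<in> carrier (Sigma_monoid A) \<and> \<psi> \<in> carrier (Sigma_monoid A) \<and> dom \<phi> = dom \<psi> \<and> ran \<phi> = ran \<psi> \<and>
    (\<exists>m \<in> Units (multiplier_monoid (A\<lparr>carrier := ran \<phi>\<rparr>)). \<forall>s \<in> dom \<phi>.
      the (\<psi> s) = two_sided m (the (\<phi> s)) (inv\<^bsub>multiplier_monoid (A\<lparr>carrier := ran \<phi>\<rparr>)\<^esub> m))"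
  by (auto simp: Sigma_cong_def Let_def)

lemma the_in_ran: "s \<in> dom \<phi> \<Longrightarrow> the (\<phi> s) \<in> ran \<phi>"
  by (auto simp: ran_def)

context inverse_semigroup
begin

lemma ideal_multiplier_monoid:
  assumes "semigroup_ideal S I"
  shows "monoid (multiplier_monoid (S\<lparr>carrier := I\<rparr>))"
  by (rule multiplier_monoid_is_monoid) (use assms in \<open>auto simp: semigroup_ideal_def\<close>)

text \<open>An ideal contains \<open>x^-1 x\<close> along with \<open>x\<close>. This supplies the
  factorization required by \<open>two_sided_mult\<close>.\<close>

lemma ideal_square:
  assumes "semigroup_ideal S I" "x \<in> I"
  shows "\<exists>t \<in> I. \<exists>u \<in> I. x = t \<otimes> u"
proof (intro bexI)
  have "x \<in> carrier S" using assms by (rule semigroup_ideal_absorb)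
  then show "x = x \<otimes> (sinv S x \<otimes> x)" "x \<in> I" "sinv S x \<otimes> x \<in> I"
    using assms semigroup_ideal_absorb(2)[OF assms, of "sinv S x"] by simp_all
qed

lemma sym_Sigma_cong: "sym (Sigma_cong S)"
proof (rule symI)
  fix \<phi> \<psi> assume *: "(\<phi>, \<psi>) \<in> Sigma_cong S"
  let ?M = "multiplier_monoid (S\<lparr>carrier := ran \<phi>\<rparr>)"
  from * have Sig: "\<phi> \<in> carrier (Sigma_monoid S)" "\<psi> \<in> carrier (Sigma_monoid S)"
    and dr: "dom \<phi> = dom \<psi>" "ran \<phi> = ran \<psi>" unfolding Sigma_cong_iff by blast+
  from * obtain m where m: "m \<in> Units ?M"
      "\<forall>s \<in> dom \<phi>. the (\<psi> s) = two_sided m (the (\<phi> s)) (inv\<^bsub>?M\<^esub> m)"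
    unfolding Sigma_cong_iff by blast
  have ideal: "semigroup_ideal S (ran \<phi>)" using Sig by (simp add: Sigma_monoidD)
  interpret M: monoid ?M using ideal by (rule ideal_multiplier_monoid)
  have "the (\<phi> s) = two_sided (inv\<^bsub>?M\<^esub> m) (the (\<psi> s)) (inv\<^bsub>?M\<^esub> (inv\<^bsub>?M\<^esub> m))" if "s \<in> dom \<phi>" for s
  proof -
    have s: "the (\<phi> s) \<in> ran \<phi>" using that by (rule the_in_ran)
    have "two_sided (inv\<^bsub>?M\<^esub> m) (two_sided m (the (\<phi> s)) (inv\<^bsub>?M\<^esub> m)) m
        = two_sided (inv\<^bsub>?M\<^esub> m \<otimes>\<^bsub>?M\<^esub> m) (the (\<phi> s)) (inv\<^bsub>?M\<^esub> m \<otimes>\<^bsub>?M\<^esub> m)"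
      using m(1) s ideal_square[OF ideal] by (intro two_sided_mult) auto
    also have "\<dots> = the (\<phi> s)"
      using m(1) s two_sided_one[of "the (\<phi> s)" "S\<lparr>carrier := ran \<phi>\<rparr>"]
      by (simp del: multiplier_monoid_simps two_sided_one)
    finally show ?thesis using m that by simp
  qed
  then show "(\<psi>, \<phi>) \<in> Sigma_cong S"
    unfolding Sigma_cong_iff dr[symmetric] using Sig m(1) by blast
qed

lemma trans_Sigma_cong: "trans (Sigma_cong S)"
proof (rule transI)
  fix \<phi> \<psi> \<chi> assume *: "(\<phi>, \<psi>) \<in> Sigma_cong S" "(\<psi>, \<chi>) \<in> Sigma_cong S"
  let ?M = "multiplier_monoid (S\<lparr>carrier := ran \<phi>\<rparr>)"
  from * have Sig: "\<phi> \<in> carrier (Sigma_monoid S)" "\<chi> \<in> carrier (Sigma_monoid S)"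
    and dr: "dom \<phi> = dom \<psi>" "ran \<phi> = ran \<psi>" "dom \<phi> = dom \<chi>" "ran \<phi> = ran \<chi>"
    unfolding Sigma_cong_iff by auto
  from * obtain m n where m: "m \<in> Units ?M"
      "\<forall>s \<in> dom \<phi>. the (\<psi> s) = two_sided m (the (\<phi> s)) (inv\<^bsub>?M\<^esub> m)"
    and n: "n \<in> Units ?M"
      "\<forall>s \<in> dom \<phi>. the (\<chi> s) = two_sided n (the (\<psi> s)) (inv\<^bsub>?M\<^esub> n)"
    unfolding Sigma_cong_iff by auto
  have ideal: "semigroup_ideal S (ran \<phi>)" using Sig by (simp add: Sigma_monoidD)
  interpret M: monoid ?M using ideal by (rule ideal_multiplier_monoid)
  have "the (\<chi> s) = two_sided (n \<otimes>\<^bsub>?M\<^esub> m) (the (\<phi> s)) (inv\<^bsub>?M\<^esub> (n \<otimes>\<^bsub>?M\<^esub> m))" if "s \<in> dom \<phi>" for s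
  proof -
    have s: "the (\<phi> s) \<in> ran \<phi>" using that by (rule the_in_ran)
    have "two_sided n (two_sided m (the (\<phi> s)) (inv\<^bsub>?M\<^esub> m)) (inv\<^bsub>?M\<^esub> n)
        = two_sided (n \<otimes>\<^bsub>?M\<^esub> m) (the (\<phi> s)) (inv\<^bsub>?M\<^esub> m \<otimes>\<^bsub>?M\<^esub> inv\<^bsub>?M\<^esub> n)"
      using m(1) n(1) s ideal_square[OF ideal] by (intro two_sided_mult) auto
    then show ?thesis using m n that by (simp add: M.inv_mult_Units)
  qed
  then show "(\<phi>, \<chi>) \<in> Sigma_cong S"
    unfolding Sigma_cong_iff using Sig m(1) n(1) dr by (metis M.Units_m_closed)
qed

lemma Sigma_cong_class_eq:
  "(\<phi>, \<psi>) \<in> Sigma_cong S \<Longrightarrow> Sigma_cong S `` {\<phi>} = Sigma_cong S `` {\<psi>}"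
  using sym_Sigma_cong trans_Sigma_cong unfolding sym_def trans_def by blast

end

section \<open>Invertible multipliers from compatible families\<close>

context semilattice_of_groups
begin

text \<open>A family of elements \<open>c e\<close> of the maximal subgroups of an ideal, one for each of its idempotents
and compatible with restriction, acts on the ideal by left and right multiplication.\<close>

definition family_multiplier :: "'a set \<Rightarrow> ('a \<Rightarrow> 'a) \<Rightarrow> ('a \<Rightarrow> 'a) \<times> ('a \<Rightarrow> 'a)" where
  "family_multiplier I c =
    (\<lambda>b \<in> I. c (b \<otimes> sinv S b) \<otimes> b, \<lambda>b \<in> I. b \<otimes> c (b \<otimes> sinv S b))"

text \<open>The equation for \<open>c e\<close> places it in the maximal subgroup with identity
  \<open>e\<close>, and multiplication by \<open>f\<close> is the structure map from that subgroup
  to the one at \<open>e f\<close>. Such a family, read on the idempotents of an ideal, is an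
  element of the inverse limit of its maximal subgroups.\<close>

definition compatible_family :: "'a set \<Rightarrow> ('a \<Rightarrow> 'a) \<Rightarrow> bool" where
  "compatible_family I c \<longleftrightarrow>
    (\<forall>e \<in> I \<inter> idempotents S. c e \<in> carrier S \<and> c e \<otimes> sinv S (c e) = e \<and>
      (\<forall>f \<in> idempotents S. c (e \<otimes> f) = c e \<otimes> f))"

lemma ideal_mult_sinv:
  assumes "semigroup_ideal S I" "b \<in> I"
  shows "b \<otimes> sinv S b \<in> I \<inter> idempotents S"
  using semigroup_ideal_absorb(1)[OF assms] semigroup_ideal_absorb(3)[OF assms] by simp

text \<open>As idempotents commute, the group element at the support of \<open>b d\<close> is a
  restriction both of the one at \<open>b\<close> and of the one at \<open>d\<close>. The left law
  uses the first form, the right law the second, and the linking law equates the two.\<close>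

lemma family_multiplier_closed:
  assumes ideal: "semigroup_ideal S I" and c: "compatible_family I c"
  shows "family_multiplier I c \<in> carrier (multiplier_monoid (S\<lparr>carrier := I\<rparr>))"
proof -
  have cc: "c (b \<otimes> sinv S b) \<in> carrier S" if "b \<in> I" for b
    using c ideal_mult_sinv[OF ideal that] unfolding compatible_family_def by blast
  have I: "b \<in> carrier S" if "b \<in> I" for b
    using ideal that by (rule semigroup_ideal_absorb)
  have c_mult: "c (b \<otimes> d \<otimes> sinv S (b \<otimes> d)) = c (b \<otimes> sinv S b) \<otimes> (d \<otimes> sinv S d)"
      "c (b \<otimes> d \<otimes> sinv S (b \<otimes> d)) = c (d \<otimes> sinv S d) \<otimes> (b \<otimes> sinv S b)"
    if "b \<in> I" "d \<in> I" for b d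
    using that c ideal_mult_sinv[OF ideal] I mult_sinv_of_mult idempotents_commute
    unfolding compatible_family_def by (metis IntD2)+
  have left: "c (b \<otimes> d \<otimes> sinv S (b \<otimes> d)) \<otimes> (b \<otimes> d) = c (b \<otimes> sinv S b) \<otimes> b \<otimes> d"
    if "b \<in> I" "d \<in> I" for b d
  proof -
    note [simp] = that[THEN I] that[THEN cc]
    have "c (b \<otimes> d \<otimes> sinv S (b \<otimes> d)) \<otimes> (b \<otimes> d) = c (b \<otimes> sinv S b) \<otimes> (d \<otimes> sinv S d \<otimes> b) \<otimes> d"
      unfolding c_mult(1)[OF that] by simp
    also have "d \<otimes> sinv S d \<otimes> b = b \<otimes> (d \<otimes> sinv S d)"
      by (simp add: idempotents_central del: m_assoc)
    finally show ?thesis by simp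
  qed
  have right: "(b \<otimes> d) \<otimes> c (b \<otimes> d \<otimes> sinv S (b \<otimes> d)) = b \<otimes> (d \<otimes> c (d \<otimes> sinv S d))"
    if "b \<in> I" "d \<in> I" for b d
  proof -
    note [simp] = that[THEN I] that[THEN cc]
    have "b \<otimes> d \<otimes> c (b \<otimes> d \<otimes> sinv S (b \<otimes> d)) = b \<otimes> d \<otimes> c (d \<otimes> sinv S d) \<otimes> (b \<otimes> sinv S b)"
      unfolding c_mult(2)[OF that] by simp
    also have "\<dots> = b \<otimes> sinv S b \<otimes> (b \<otimes> d \<otimes> c (d \<otimes> sinv S d))"
      by (rule idempotents_central[symmetric]) simp_all
    finally show ?thesis by simp
  qed
  have mid: "b \<otimes> (c (d \<otimes> sinv S d) \<otimes> d) = b \<otimes> c (b \<otimes> sinv S b) \<otimes> d"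
    if "b \<in> I" "d \<in> I" for b d
  proof -
    note [simp] = that[THEN I] that[THEN cc]
    have "b \<otimes> (b \<otimes> sinv S b) = b"
      by (simp add: idempotents_central[of "b \<otimes> sinv S b" b, symmetric])
    then have "b \<otimes> (c (d \<otimes> sinv S d) \<otimes> d) = b \<otimes> (b \<otimes> sinv S b \<otimes> c (d \<otimes> sinv S d)) \<otimes> d"
      by (metis I cc m_assoc m_closed that sinv_closed)
    \<comment> \<open>Both sides are the value of \<open>c\<close> at the support of
      \<open>b d\<close>.\<close>
    also have "b \<otimes> sinv S b \<otimes> c (d \<otimes> sinv S d) = c (b \<otimes> sinv S b) \<otimes> (d \<otimes> sinv S d)"
      using c_mult[OF that] by (simp add: idempotents_central[of "b \<otimes> sinv S b"] del: m_assoc)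
    finally show ?thesis by simp
  qed
  have closed: "b \<otimes> d \<in> I" "c (b \<otimes> sinv S b) \<otimes> b \<in> I" "b \<otimes> c (b \<otimes> sinv S b) \<in> I"
    if "b \<in> I" "d \<in> I" for b d
    using that cc I ideal by (simp_all add: semigroup_ideal_def)
  show ?thesis
    unfolding family_multiplier_def in_multiplier_monoid_iff
    by (intro conjI ballI) (simp_all add: closed left right mid del: m_assoc)
qed

lemma compatible_familyD:
  assumes "semigroup_ideal S I" "compatible_family I c" "b \<in> I"
  shows "c (b \<otimes> sinv S b) \<in> carrier S"
    and "c (b \<otimes> sinv S b) \<otimes> sinv S (c (b \<otimes> sinv S b)) = b \<otimes> sinv S b"
  using assms(2) ideal_mult_sinv[OF assms(1,3)] by (auto simp: compatible_family_def)

lemma compatible_family_sinv: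
  assumes "compatible_family I c"
  shows "compatible_family I (\<lambda>e. sinv S (c e))"
  unfolding compatible_family_def
proof (intro ballI conjI)
  fix e assume "e \<in> I \<inter> idempotents S"
  with assms have ce [simp]: "c e \<in> carrier S" and "c e \<otimes> sinv S (c e) = e"
    and mult: "\<And>f. f \<in> idempotents S \<Longrightarrow> c (e \<otimes> f) = c e \<otimes> f"
    by (auto simp: compatible_family_def)
  then show "sinv S (c e) \<in> carrier S" "sinv S (c e) \<otimes> sinv S (sinv S (c e)) = e"
    by (simp_all add: sinv_mult_comm)
  fix f assume "f \<in> idempotents S"
  then show "sinv S (c (e \<otimes> f)) = sinv S (c e) \<otimes> f"
    by (simp add: mult sinv_mult idempotentsD idempotents_central[of f "sinv S (c e)"])
qed

text \<open>Multiplying \<open>b\<close> by the group element at its own support stays in the same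
  maximal subgroup. A second family applied afterwards is therefore evaluated at the same
  idempotent, so families multiply pointwise.\<close>

lemma compatible_family_mult_sinv:
  assumes "semigroup_ideal S I" "compatible_family I c" and [simp]: "b \<in> I"
  shows "c (b \<otimes> sinv S b) \<otimes> b \<otimes> sinv S (c (b \<otimes> sinv S b) \<otimes> b) = b \<otimes> sinv S b"
    and "b \<otimes> c (b \<otimes> sinv S b) \<otimes> sinv S (b \<otimes> c (b \<otimes> sinv S b)) = b \<otimes> sinv S b"
proof -
  note c = compatible_familyD[OF assms]
  have b: "b \<in> carrier S" using assms(1,3) by (rule semigroup_ideal_absorb)
  show "c (b \<otimes> sinv S b) \<otimes> b \<otimes> sinv S (c (b \<otimes> sinv S b) \<otimes> b) = b \<otimes> sinv S b"
    unfolding mult_sinv_of_mult[OF c(1) b] c(2) using b by simp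
  show "b \<otimes> c (b \<otimes> sinv S b) \<otimes> sinv S (b \<otimes> c (b \<otimes> sinv S b)) = b \<otimes> sinv S b"
    unfolding mult_sinv_of_mult[OF b c(1)] c(2) using b by simp
qed

lemma family_multiplier_mult_sinv:
  assumes ideal: "semigroup_ideal S I" and c: "compatible_family I c"
  shows "family_multiplier I c \<otimes>\<^bsub>multiplier_monoid (S\<lparr>carrier := I\<rparr>)\<^esub> family_multiplier I (\<lambda>e. sinv S (c e))
    = \<one>\<^bsub>multiplier_monoid (S\<lparr>carrier := I\<rparr>)\<^esub>"
proof -
  let ?c' = "\<lambda>e. sinv S (c e)"
  note c' = compatible_family_sinv[OF c]
  have left: "c (x \<otimes> sinv S x) \<otimes> x = b" if "b \<in> I" "x = ?c' (b \<otimes> sinv S b) \<otimes> b" for b x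
  proof -
    have b: "b \<in> carrier S" using ideal that(1) by (rule semigroup_ideal_absorb)
    have "c (x \<otimes> sinv S x) \<otimes> x = c (b \<otimes> sinv S b) \<otimes> sinv S (c (b \<otimes> sinv S b)) \<otimes> b"
      using that b compatible_familyD[OF ideal c that(1)] compatible_family_mult_sinv(1)[OF ideal c' that(1)]
      by (metis m_assoc sinv_closed)
    then show ?thesis
      using b compatible_familyD[OF ideal c that(1)] by simp
  qed
  have right: "x \<otimes> ?c' (x \<otimes> sinv S x) = b" if "b \<in> I" "x = b \<otimes> c (b \<otimes> sinv S b)" for b x
  proof -
    have b: "b \<in> carrier S" using ideal that(1) by (rule semigroup_ideal_absorb)
    have "x \<otimes> ?c' (x \<otimes> sinv S x) = b \<otimes> (c (b \<otimes> sinv S b) \<otimes> sinv S (c (b \<otimes> sinv S b)))"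
      using that b compatible_familyD[OF ideal c that(1)] compatible_family_mult_sinv(2)[OF ideal c that(1)]
      by (metis m_assoc sinv_closed)
    then show ?thesis
      using b compatible_familyD[OF ideal c that(1)] by (simp add: sinv_mult_comm[symmetric])
  qed
  have closed: "?c' (b \<otimes> sinv S b) \<otimes> b \<in> I" "b \<otimes> c (b \<otimes> sinv S b) \<in> I" if "b \<in> I" for b
    using that ideal compatible_familyD(1)[OF ideal c that] sinv_closed
    by (simp_all add: semigroup_ideal_def)
  show ?thesis
    by (auto simp: family_multiplier_def compose_def closed left[OF _ refl] right[OF _ refl]
        intro!: restrict_ext simp del: m_assoc)
qed

lemma family_multiplier_unit:
  assumes ideal: "semigroup_ideal S I" and c: "compatible_family I c"
  shows "family_multiplier I c \<in> Units (multiplier_monoid (S\<lparr>carrier := I\<rparr>))"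
    and "inv\<^bsub>multiplier_monoid (S\<lparr>carrier := I\<rparr>)\<^esub> (family_multiplier I c)
      = family_multiplier I (\<lambda>e. sinv S (c e))"
proof -
  let ?M = "multiplier_monoid (S\<lparr>carrier := I\<rparr>)"
  let ?c' = "\<lambda>e. sinv S (c e)"
  interpret M: monoid ?M using ideal by (rule ideal_multiplier_monoid)
  note c' = compatible_family_sinv[OF c]
  \<comment> \<open>Inverting twice returns \<open>c\<close> at supports of elements of
    \<open>I\<close>, where its values are known to lie in the semigroup; hence an equality of
    multipliers and not of functions.\<close>
  have eq: "family_multiplier I (\<lambda>e. sinv S (?c' e)) = family_multiplier I c"
    using compatible_familyD(1)[OF ideal c] by (auto simp: family_multiplier_def intro!: restrict_ext)
  have inv: "family_multiplier I c \<otimes>\<^bsub>?M\<^esub> family_multiplier I ?c' = \<one>\<^bsub>?M\<^esub>"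
    "family_multiplier I ?c' \<otimes>\<^bsub>?M\<^esub> family_multiplier I c = \<one>\<^bsub>?M\<^esub>"
    using family_multiplier_mult_sinv[OF ideal c] family_multiplier_mult_sinv[OF ideal c']
    unfolding eq by blast+
  note closed = family_multiplier_closed[OF ideal c] family_multiplier_closed[OF ideal c']
  show "family_multiplier I c \<in> Units ?M"
    unfolding Units_def using inv closed by blast
  show "inv\<^bsub>?M\<^esub> (family_multiplier I c) = family_multiplier I ?c'"
    using inv closed by (metis M.inv_unique')
qed

text \<open>Translates the abstract conjugation in the congruence into conjugation by one group
  element, because the left action does not change the support of \<open>b\<close>.\<close>

lemma two_sided_family_multiplier:
  assumes ideal: "semigroup_ideal S I" and c: "compatible_family I c" and b: "b \<in> I"
  shows "two_sided (family_multiplier I c) b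
      (inv\<^bsub>multiplier_monoid (S\<lparr>carrier := I\<rparr>)\<^esub> (family_multiplier I c))
    = c (b \<otimes> sinv S b) \<otimes> b \<otimes> sinv S (c (b \<otimes> sinv S b))"
proof -
  have "c (b \<otimes> sinv S b) \<otimes> b \<in> I"
    using ideal b compatible_familyD(1)[OF ideal c b] by (simp add: semigroup_ideal_def)
  then show ?thesis
    unfolding family_multiplier_unit(2)[OF ideal c]
    using b compatible_family_mult_sinv(1)[OF ideal c b]
    by (simp add: two_sided_def family_multiplier_def del: m_assoc)
qed

end

section \<open>Extensions by groups\<close>

text \<open>No refinement is mentioned here, so sections and conjugations depend on the extension
  alone. Extensions refined over different types thus become comparable.\<close>

locale group_extension =
  A: semilattice_of_groups A + U: inverse_semigroup U + G: group G
  for A :: "'a monoid" and U :: "'u monoid" and G :: "'g monoid" +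
  fixes i :: "'a \<Rightarrow> 'u" and j :: "'u \<Rightarrow> 'g"
  assumes i_mon: "i \<in> mon A U" and j_epi: "j \<in> epi U G"
    and kernel: "i ` carrier A = {u \<in> carrier U. j u = \<one>\<^bsub>G\<^esub>}"
begin

abbreviation supp :: "'a \<Rightarrow> 'a" where
  "supp a \<equiv> a \<otimes>\<^bsub>A\<^esub> sinv A a"

section \<open>The copy of \<open>A\<close> inside \<open>U\<close>\<close>

lemma i_hom: "i \<in> hom A U" and j_hom: "j \<in> hom U G"
  using i_mon j_epi by (auto simp: mon_def epi_def)

lemma i_closed [simp]: "a \<in> carrier A \<Longrightarrow> i a \<in> carrier U"
  and j_closed [simp]: "u \<in> carrier U \<Longrightarrow> j u \<in> carrier G"
  and i_mult [simp]: "a \<in> carrier A \<Longrightarrow> b \<in> carrier A \<Longrightarrow> i (a \<otimes>\<^bsub>A\<^esub> b) = i a \<otimes>\<^bsub>U\<^esub> i b"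
  and j_mult [simp]: "u \<in> carrier U \<Longrightarrow> v \<in> carrier U \<Longrightarrow> j (u \<otimes>\<^bsub>U\<^esub> v) = j u \<otimes>\<^bsub>G\<^esub> j v"
  using i_hom j_hom by (auto simp: hom_def)

lemma i_sinv [simp]: "a \<in> carrier A \<Longrightarrow> i (sinv A a) = sinv U (i a)"
  using A.hom_sinv[OF U.inverse_semigroup_axioms i_hom] .

lemma j_sinv [simp]: "u \<in> carrier U \<Longrightarrow> j (sinv U u) = inv\<^bsub>G\<^esub> (j u)"
  using U.group_hom_sinv[OF G.group_axioms j_hom] .

lemma i_eq_iff: "a \<in> carrier A \<Longrightarrow> b \<in> carrier A \<Longrightarrow> i a = i b \<longleftrightarrow> a = b"
  using i_mon by (auto simp: mon_def inj_on_def)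

lemma j_i [simp]: "a \<in> carrier A \<Longrightarrow> j (i a) = \<one>\<^bsub>G\<^esub>"
  using kernel by blast

lemma in_kernelE:
  assumes "u \<in> carrier U" "j u = \<one>\<^bsub>G\<^esub>"
  obtains a where "a \<in> carrier A" "u = i a"
  using assms kernel by blast

lemma i_inv_into: "u \<in> carrier U \<Longrightarrow> j u = \<one>\<^bsub>G\<^esub> \<Longrightarrow> i (inv_into (carrier A) i u) = u"
  and inv_into_closed: "u \<in> carrier U \<Longrightarrow> j u = \<one>\<^bsub>G\<^esub> \<Longrightarrow> inv_into (carrier A) i u \<in> carrier A"
  using kernel by (auto intro!: f_inv_into_f inv_into_into)

lemma inv_into_i [simp]: "a \<in> carrier A \<Longrightarrow> inv_into (carrier A) i (i a) = a"
  using i_mon by (simp add: mon_def)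

lemma i_idempotent [simp]: "e \<in> idempotents A \<Longrightarrow> i e \<in> idempotents U"
  using i_hom by (rule idempotents_hom)

text \<open>The only idempotent of a group is its unit, so every idempotent of \<open>U\<close> lies
  in the kernel of \<open>j\<close>; injectivity of \<open>i\<close> makes its preimage
  idempotent.\<close>

lemma idempotentE:
  assumes "e \<in> idempotents U"
  obtains e' where "e' \<in> idempotents A" "e = i e'"
proof -
  have "j e \<otimes>\<^bsub>G\<^esub> j e = j e" "j e \<in> carrier G"
    using idempotentsD[OF assms] by (simp_all flip: j_mult)
  then have "j e = \<one>\<^bsub>G\<^esub>" by (metis G.r_cancel_one')
  then obtain a where a: "a \<in> carrier A" "e = i a"
    using idempotentsD(1)[OF assms] by (blast elim: in_kernelE)
  then have "i (a \<otimes>\<^bsub>A\<^esub> a) = i a" using idempotentsD(2)[OF assms] by simp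
  then have "a \<in> idempotents A" using a by (simp add: i_eq_iff idempotents_def del: i_mult)
  then show thesis using a(2) that by blast
qed

lemma idempotent_commutes_i:
  assumes "e \<in> idempotents U" "a \<in> carrier A"
  shows "e \<otimes>\<^bsub>U\<^esub> i a = i a \<otimes>\<^bsub>U\<^esub> e"
proof -
  obtain e' where e': "e' \<in> idempotents A" "e = i e'"
    using assms(1) by (rule idempotentE)
  have "i (e' \<otimes>\<^bsub>A\<^esub> a) = i (a \<otimes>\<^bsub>A\<^esub> e')"
    using A.idempotents_central[OF e'(1) assms(2)] by simp
  then show ?thesis
    using e' idempotentsD(1)[OF e'(1)] assms(2) by simp
qed

lemma kernel_sinv_mult_comm:
  assumes "u \<in> carrier U" "j u = \<one>\<^bsub>G\<^esub>"
  shows "sinv U u \<otimes>\<^bsub>U\<^esub> u = u \<otimes>\<^bsub>U\<^esub> sinv U u"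
proof -
  obtain a where a: "a \<in> carrier A" "u = i a"
    using assms by (rule in_kernelE)
  have "i (sinv A a \<otimes>\<^bsub>A\<^esub> a) = i (a \<otimes>\<^bsub>A\<^esub> sinv A a)"
    using a by (simp only: A.sinv_mult_comm)
  then show ?thesis using a by simp
qed

text \<open>The element \<open>u^-1 v\<close> lies over the unit, so its source and range agree.
  Because the ranges of \<open>u\<close> and \<open>v\<close> coincide, these are the source of
  \<open>v\<close> and the source of \<open>u\<close>.\<close>

lemma source_eq_if_range_eq:
  assumes [simp]: "u \<in> carrier U" "v \<in> carrier U" and "j u = j v"
    and ranges: "u \<otimes>\<^bsub>U\<^esub> sinv U u = v \<otimes>\<^bsub>U\<^esub> sinv U v"
  shows "sinv U u \<otimes>\<^bsub>U\<^esub> u = sinv U v \<otimes>\<^bsub>U\<^esub> v"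
proof -
  let ?p = "sinv U u \<otimes>\<^bsub>U\<^esub> v"
  have "j ?p = \<one>\<^bsub>G\<^esub>" using assms by simp
  then have "sinv U ?p \<otimes>\<^bsub>U\<^esub> ?p = ?p \<otimes>\<^bsub>U\<^esub> sinv U ?p"
    by (intro kernel_sinv_mult_comm) simp_all
  moreover have "sinv U ?p \<otimes>\<^bsub>U\<^esub> ?p = sinv U v \<otimes>\<^bsub>U\<^esub> v"
  proof -
    have "sinv U ?p \<otimes>\<^bsub>U\<^esub> ?p = sinv U v \<otimes>\<^bsub>U\<^esub> (u \<otimes>\<^bsub>U\<^esub> sinv U u) \<otimes>\<^bsub>U\<^esub> v"
      by (simp add: U.sinv_mult)
    then show ?thesis unfolding ranges by simp
  qed
  moreover have "?p \<otimes>\<^bsub>U\<^esub> sinv U ?p = sinv U u \<otimes>\<^bsub>U\<^esub> u"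
  proof -
    have "?p \<otimes>\<^bsub>U\<^esub> sinv U ?p = sinv U u \<otimes>\<^bsub>U\<^esub> (v \<otimes>\<^bsub>U\<^esub> sinv U v) \<otimes>\<^bsub>U\<^esub> u"
      by (simp add: U.sinv_mult)
    then show ?thesis unfolding ranges[symmetric] by simp
  qed
  ultimately show ?thesis by simp
qed

lemma range_eq_if_source_eq:
  assumes "u \<in> carrier U" "v \<in> carrier U" "j u = j v"
    and "sinv U u \<otimes>\<^bsub>U\<^esub> u = sinv U v \<otimes>\<^bsub>U\<^esub> v"
  shows "u \<otimes>\<^bsub>U\<^esub> sinv U u = v \<otimes>\<^bsub>U\<^esub> sinv U v"
  using source_eq_if_range_eq[of "sinv U u" "sinv U v"] assms by simp

section \<open>The ideals between which the kernel isomorphisms act\<close>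

definition range_ideal :: "'g \<Rightarrow> 'a set" where
  "range_ideal g = {a \<in> carrier A. \<exists>u \<in> carrier U. j u = g \<and> u \<otimes>\<^bsub>U\<^esub> sinv U u = i (supp a)}"

text \<open>Passing from \<open>u\<close> to \<open>u^-1\<close> exchanges source and range and
  inverts \<open>j u\<close>. This gives the description by sources that suits the domain of
  \<theta>_g.\<close>

lemma range_ideal_inv_iff:
  assumes "g \<in> carrier G"
  shows "a \<in> range_ideal (inv\<^bsub>G\<^esub> g) \<longleftrightarrow>
    a \<in> carrier A \<and> (\<exists>u \<in> carrier U. j u = g \<and> sinv U u \<otimes>\<^bsub>U\<^esub> u = i (supp a))"
proof
  assume "a \<in> range_ideal (inv\<^bsub>G\<^esub> g)"
  then obtain u where "a \<in> carrier A" "u \<in> carrier U" "j u = inv\<^bsub>G\<^esub> g" "u \<otimes>\<^bsub>U\<^esub> sinv U u = i (supp a)"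
    unfolding range_ideal_def by blast
  then show "a \<in> carrier A \<and> (\<exists>u \<in> carrier U. j u = g \<and> sinv U u \<otimes>\<^bsub>U\<^esub> u = i (supp a))"
    using assms by (intro conjI bexI[of _ "sinv U u"]) simp_all
next
  assume "a \<in> carrier A \<and> (\<exists>u \<in> carrier U. j u = g \<and> sinv U u \<otimes>\<^bsub>U\<^esub> u = i (supp a))"
  then obtain u where "a \<in> carrier A" "u \<in> carrier U" "j u = g" "sinv U u \<otimes>\<^bsub>U\<^esub> u = i (supp a)"
    by blast
  then show "a \<in> range_ideal (inv\<^bsub>G\<^esub> g)"
    unfolding range_ideal_def by (intro CollectI conjI bexI[of _ "sinv U u"]) simp_all
qed

lemma supp_idempotent [simp]: "e \<in> idempotents A \<Longrightarrow> supp e = e"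
  by (simp add: idempotentsD)

text \<open>Membership depends on the support only, so one argument serves for products on either
  side. The witness is \<open>u\<close> cut down on the left by \<open>i (supp b)\<close>.\<close>

lemma range_ideal_mult:
  assumes "a \<in> range_ideal g" "b \<in> carrier A" "c \<in> carrier A" "g \<in> carrier G"
    and supp: "supp c = supp b \<otimes>\<^bsub>A\<^esub> supp a"
  shows "c \<in> range_ideal g"
proof -
  obtain u where u: "a \<in> carrier A" "u \<in> carrier U" "j u = g" "u \<otimes>\<^bsub>U\<^esub> sinv U u = i (supp a)"
    using assms(1) unfolding range_ideal_def by blast
  let ?f = "i (supp b)"
  have f: "?f \<in> idempotents U" "?f \<in> carrier U"
    using assms(2) by (simp_all del: i_mult)
  have "?f \<otimes>\<^bsub>U\<^esub> u \<otimes>\<^bsub>U\<^esub> sinv U (?f \<otimes>\<^bsub>U\<^esub> u) = ?f \<otimes>\<^bsub>U\<^esub> (u \<otimes>\<^bsub>U\<^esub> sinv U u) \<otimes>\<^bsub>U\<^esub> ?f"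
    using f u(2) by (simp add: U.sinv_mult del: i_mult)
  also have "\<dots> = ?f \<otimes>\<^bsub>U\<^esub> (u \<otimes>\<^bsub>U\<^esub> sinv U u)"
    using f u(2) U.idempotents_commute[OF f(1), of "u \<otimes>\<^bsub>U\<^esub> sinv U u"]
    by (metis U.idempotent_left_absorb U.idempotent_sinv_mult(2) U.m_assoc idempotentsD(1))
  also have "\<dots> = i (supp c)"
    unfolding u(4) supp by (rule i_mult[symmetric]) (use assms(2) u(1) in simp_all)
  finally have "?f \<otimes>\<^bsub>U\<^esub> u \<otimes>\<^bsub>U\<^esub> sinv U (?f \<otimes>\<^bsub>U\<^esub> u) = i (supp c)" .
  moreover have "?f \<otimes>\<^bsub>U\<^esub> u \<in> carrier U" "j (?f \<otimes>\<^bsub>U\<^esub> u) = g"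
    using u(2,3) f(2) assms(2,4) by (simp_all del: i_mult)
  ultimately show ?thesis
    unfolding range_ideal_def using assms(3) by blast
qed

lemma range_ideal_ideal:
  assumes g: "g \<in> carrier G"
  shows "semigroup_ideal A (range_ideal g)"
proof -
  \<comment> \<open>Surjectivity of \<open>j\<close> makes the ideal nonempty: the range of any
    \<open>u\<close> over \<open>g\<close> comes from an idempotent in it.\<close>
  have "g \<in> j ` carrier U" using g j_epi by (simp add: epi_def)
  then obtain u where u: "u \<in> carrier U" "j u = g" by blast
  obtain e where e: "e \<in> idempotents A" "u \<otimes>\<^bsub>U\<^esub> sinv U u = i e"
    using idempotentE[of "u \<otimes>\<^bsub>U\<^esub> sinv U u"] u(1) by auto
  have "e \<in> range_ideal g"
    unfolding range_ideal_def mem_Collect_eq supp_idempotent[OF e(1)]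
    using u e(2) idempotentsD(1)[OF e(1)] by blast
  moreover have "b \<otimes>\<^bsub>A\<^esub> a \<in> range_ideal g" "a \<otimes>\<^bsub>A\<^esub> b \<in> range_ideal g"
    if "a \<in> range_ideal g" "b \<in> carrier A" for a b
  proof -
    have a: "a \<in> carrier A" using that(1) by (simp add: range_ideal_def)
    have supp: "supp (b \<otimes>\<^bsub>A\<^esub> a) = supp b \<otimes>\<^bsub>A\<^esub> supp a" "supp (a \<otimes>\<^bsub>A\<^esub> b) = supp b \<otimes>\<^bsub>A\<^esub> supp a"
      using A.mult_sinv_of_mult[OF that(2) a] A.mult_sinv_of_mult[OF a that(2)]
        A.idempotents_commute[of "supp a" "supp b"] a that(2) by simp_all
    show "b \<otimes>\<^bsub>A\<^esub> a \<in> range_ideal g" "a \<otimes>\<^bsub>A\<^esub> b \<in> range_ideal g"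
      using range_ideal_mult[OF that A.m_closed[OF that(2) a] g supp(1)]
        range_ideal_mult[OF that A.m_closed[OF a that(2)] g supp(2)] by blast+
  qed
  ultimately show ?thesis
    unfolding semigroup_ideal_def range_ideal_def by blast
qed

lemma supp_in_range_ideal:
  assumes "a \<in> range_ideal g"
  shows "supp a \<in> range_ideal g" "supp a \<in> idempotents A"
proof -
  have "a \<in> carrier A" using assms by (simp add: range_ideal_def)
  then show "supp a \<in> idempotents A" by simp
  then show "supp a \<in> range_ideal g"
    using assms \<open>a \<in> carrier A\<close> unfolding range_ideal_def mem_Collect_eq
    by (simp only: supp_idempotent A.m_closed A.sinv_closed)
qed

text \<open>A section over \<open>g\<close> lifts the idempotents \<open>e\<close> of the domain of \<open>\<theta>\<^sub>g\<close> to elements \<open>w e\<close> of \<open>U\<close> over \<open>g\<close>.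
It retains from a refinement with an order-preserving transversal what \<open>\<theta>\<^sub>g\<close> depends on.\<close>

definition "section" :: "'g \<Rightarrow> ('a \<Rightarrow> 'u) \<Rightarrow> bool" where
  "section g w \<longleftrightarrow> (\<forall>e \<in> idempotents A \<inter> range_ideal (inv\<^bsub>G\<^esub> g).
    w e \<in> carrier U \<and> j (w e) = g \<and> sinv U (w e) \<otimes>\<^bsub>U\<^esub> w e = i e \<and>
    (\<forall>f \<in> idempotents A. w (e \<otimes>\<^bsub>A\<^esub> f) = w e \<otimes>\<^bsub>U\<^esub> i f))"

definition conjugate :: "('a \<Rightarrow> 'u) \<Rightarrow> 'a \<Rightarrow> 'a" where
  "conjugate w a = inv_into (carrier A) i (w (supp a) \<otimes>\<^bsub>U\<^esub> i a \<otimes>\<^bsub>U\<^esub> sinv U (w (supp a)))"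

definition conjugation :: "'g \<Rightarrow> ('a \<Rightarrow> 'u) \<Rightarrow> ('a \<rightharpoonup> 'a)" where
  "conjugation g w =
    (\<lambda>a. if a \<in> range_ideal (inv\<^bsub>G\<^esub> g) then Some (conjugate w a) else None)"

section \<open>Values of a section\<close>

lemma sectionD:
  assumes "section g w" "e \<in> idempotents A" "e \<in> range_ideal (inv\<^bsub>G\<^esub> g)"
  shows "w e \<in> carrier U" and "j (w e) = g" and "sinv U (w e) \<otimes>\<^bsub>U\<^esub> w e = i e"
    and "f \<in> idempotents A \<Longrightarrow> w (e \<otimes>\<^bsub>A\<^esub> f) = w e \<otimes>\<^bsub>U\<^esub> i f"
  using assms unfolding section_def by blast+

lemma section_absorb:
  assumes "section g w" "e \<in> idempotents A" "e \<in> range_ideal (inv\<^bsub>G\<^esub> g)"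
  shows "w e \<otimes>\<^bsub>U\<^esub> i e = w e" and "i e \<otimes>\<^bsub>U\<^esub> sinv U (w e) = sinv U (w e)"
  using sectionD(1)[OF assms] by (simp_all flip: sectionD(3)[OF assms])

text \<open>Values over the same \<open>g\<close> with equal ranges have equal sources, and the
  source of \<open>w e\<close> is \<open>i e\<close>. So the index of a value can be recovered from
  its range.\<close>

lemma section_range_inj:
  assumes "section g w" "g \<in> carrier G"
    and e: "e \<in> idempotents A" "e \<in> range_ideal (inv\<^bsub>G\<^esub> g)"
    and f: "f \<in> idempotents A" "f \<in> range_ideal (inv\<^bsub>G\<^esub> g)"
    and "w e \<otimes>\<^bsub>U\<^esub> sinv U (w e) = w f \<otimes>\<^bsub>U\<^esub> sinv U (w f)"
  shows "e = f"
proof -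
  note we = sectionD[OF assms(1) e] and wf = sectionD[OF assms(1) f]
  have "i e = i f"
    using source_eq_if_range_eq[OF we(1) wf(1) _ assms(7)] we wf by simp
  then show ?thesis
    using e(1) f(1) by (simp add: i_eq_iff idempotentsD)
qed

text \<open>The product \<open>p\<close> of \<open>w(e)^-1\<close> and \<open>w f\<close> lies in
  \<open>i(A)\<close>. Since \<open>p\<close> commutes with idempotents and absorbs
  \<open>i e\<close> and \<open>i f\<close>, it equals \<open>i f p i e\<close>, which is
  \<open>(w e i f)^-1 (w f i e)\<close>. By compatibility both brackets are
  \<open>w(ef)\<close>.\<close>

lemma section_sinv_mult:
  assumes w: "section g w" and g: "g \<in> carrier G"
    and e: "e \<in> idempotents A" "e \<in> range_ideal (inv\<^bsub>G\<^esub> g)"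
    and f: "f \<in> idempotents A" "f \<in> range_ideal (inv\<^bsub>G\<^esub> g)"
  shows "sinv U (w e) \<otimes>\<^bsub>U\<^esub> w f = i (e \<otimes>\<^bsub>A\<^esub> f)"
proof -
  note we = sectionD[OF w e] and wf = sectionD[OF w f]
  note [simp] = we(1) wf(1) idempotentsD(1)[OF e(1)] idempotentsD(1)[OF f(1)]
  let ?p = "sinv U (w e) \<otimes>\<^bsub>U\<^esub> w f"
  have "j ?p = \<one>\<^bsub>G\<^esub>" using we(2) wf(2) g by simp
  then obtain p where p: "p \<in> carrier A" "?p = i p"
    by (metis U.m_closed U.sinv_closed in_kernelE we(1) wf(1))
  have ef: "e \<otimes>\<^bsub>A\<^esub> f = f \<otimes>\<^bsub>A\<^esub> e"
    using A.idempotents_commute e(1) f(1) by blast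
  have ip: "i e \<otimes>\<^bsub>U\<^esub> i p = i p" "i p \<otimes>\<^bsub>U\<^esub> i f = i p"
    unfolding p(2)[symmetric] using section_absorb[OF w e] section_absorb[OF w f]
    by (simp_all flip: U.m_assoc) (simp_all)
  have comm: "i e \<otimes>\<^bsub>U\<^esub> i p = i p \<otimes>\<^bsub>U\<^esub> i e" "i f \<otimes>\<^bsub>U\<^esub> i p = i p \<otimes>\<^bsub>U\<^esub> i f"
    using idempotent_commutes_i e(1) f(1) p(1) i_idempotent by blast+
  have "?p = i f \<otimes>\<^bsub>U\<^esub> ?p \<otimes>\<^bsub>U\<^esub> i e"
    unfolding p(2) by (metis comm ip)
  also have "\<dots> = sinv U (w e \<otimes>\<^bsub>U\<^esub> i f) \<otimes>\<^bsub>U\<^esub> (w f \<otimes>\<^bsub>U\<^esub> i e)"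
    using f(1) by (simp add: U.sinv_mult)
  also have "\<dots> = i (e \<otimes>\<^bsub>A\<^esub> f)"
  proof -
    have mem: "e \<otimes>\<^bsub>A\<^esub> f \<in> idempotents A" "e \<otimes>\<^bsub>A\<^esub> f \<in> range_ideal (inv\<^bsub>G\<^esub> g)"
      using e f semigroup_ideal_absorb(3)[OF range_ideal_ideal e(2)] g by simp_all
    have "w e \<otimes>\<^bsub>U\<^esub> i f = w (e \<otimes>\<^bsub>A\<^esub> f)" "w f \<otimes>\<^bsub>U\<^esub> i e = w (e \<otimes>\<^bsub>A\<^esub> f)"
      using we(4)[OF f(1)] wf(4)[OF e(1)] ef by simp_all
    then show ?thesis using sectionD(3)[OF w mem] by simp
  qed
  finally show ?thesis .
qed

section \<open>Conjugation along a section as an isomorphism of ideals\<close>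

lemma conjugate_props:
  assumes w: "section g w" and g: "g \<in> carrier G" and a: "a \<in> range_ideal (inv\<^bsub>G\<^esub> g)"
  shows "i (conjugate w a) = w (supp a) \<otimes>\<^bsub>U\<^esub> i a \<otimes>\<^bsub>U\<^esub> sinv U (w (supp a))"
    and "conjugate w a \<in> range_ideal g"
    and "i (supp (conjugate w a)) = w (supp a) \<otimes>\<^bsub>U\<^esub> sinv U (w (supp a))"
proof -
  note e = supp_in_range_ideal[OF a]
  note we = sectionD[OF w e(2,1)]
  note [simp] = we(1)
  have ac [simp]: "a \<in> carrier A" using a by (simp add: range_ideal_def)
  let ?y = "w (supp a) \<otimes>\<^bsub>U\<^esub> i a \<otimes>\<^bsub>U\<^esub> sinv U (w (supp a))"
  have y: "?y \<in> carrier U" "j ?y = \<one>\<^bsub>G\<^esub>"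
    using we(2) g by simp_all
  then show ic: "i (conjugate w a) = ?y"
    unfolding conjugate_def by (rule i_inv_into)
  have cc: "conjugate w a \<in> carrier A"
    unfolding conjugate_def using y by (rule inv_into_closed)
  have ea: "i (supp a) \<otimes>\<^bsub>U\<^esub> (sinv U (i a)) = sinv U (i a)"
    by (simp add: kernel_sinv_mult_comm[symmetric] flip: U.m_assoc) simp
  have "?y \<otimes>\<^bsub>U\<^esub> sinv U ?y
      = w (supp a) \<otimes>\<^bsub>U\<^esub> (i a \<otimes>\<^bsub>U\<^esub> ((sinv U (w (supp a)) \<otimes>\<^bsub>U\<^esub> w (supp a)) \<otimes>\<^bsub>U\<^esub> sinv U (i a))) \<otimes>\<^bsub>U\<^esub> sinv U (w (supp a))"
    by (simp add: U.sinv_mult)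
  also have "\<dots> = w (supp a) \<otimes>\<^bsub>U\<^esub> i (supp a) \<otimes>\<^bsub>U\<^esub> sinv U (w (supp a))"
    unfolding we(3) ea by simp
  also have "\<dots> = w (supp a) \<otimes>\<^bsub>U\<^esub> sinv U (w (supp a))"
    unfolding section_absorb(1)[OF w e(2,1)] ..
  finally show supp: "i (supp (conjugate w a)) = w (supp a) \<otimes>\<^bsub>U\<^esub> sinv U (w (supp a))"
    using cc ic by simp
  then show "conjugate w a \<in> range_ideal g"
    unfolding range_ideal_def using cc we(1,2) by (metis (mono_tags, lifting) mem_Collect_eq)
qed

lemma conjugate_closed:
  assumes "section g w" "g \<in> carrier G" "a \<in> range_ideal (inv\<^bsub>G\<^esub> g)"
  shows "conjugate w a \<in> carrier A"
  using conjugate_props(2)[OF assms] by (simp add: range_ideal_def)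

lemma range_idealD: "a \<in> range_ideal g \<Longrightarrow> a \<in> carrier A"
  by (simp add: range_ideal_def)

text \<open>The two values of \<open>w\<close> meeting in the middle collapse to \<open>i e\<close>,
  where \<open>e\<close> is the support of the product. Being idempotent and commuting with
  \<open>i(A)\<close>, \<open>i e\<close> can be doubled and moved to both ends, where it restricts
  the outer values of \<open>w\<close> to \<open>w e\<close>.\<close>

lemma conjugate_mult:
  assumes w: "section g w" and g: "g \<in> carrier G"
    and a: "a \<in> range_ideal (inv\<^bsub>G\<^esub> g)" and b: "b \<in> range_ideal (inv\<^bsub>G\<^esub> g)"
  shows "conjugate w (a \<otimes>\<^bsub>A\<^esub> b) = conjugate w a \<otimes>\<^bsub>A\<^esub> conjugate w b"
proof -
  note [simp] = a[THEN range_idealD] b[THEN range_idealD]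
  note ea = supp_in_range_ideal[OF a] and eb = supp_in_range_ideal[OF b]
  note wa = sectionD[OF w ea(2,1)] and wb = sectionD[OF w eb(2,1)]
  note [simp] = wa(1) wb(1)
  define e where "e = supp a \<otimes>\<^bsub>A\<^esub> supp b"
  have e: "e \<in> idempotents A" "e = supp b \<otimes>\<^bsub>A\<^esub> supp a" "supp (a \<otimes>\<^bsub>A\<^esub> b) = e"
    unfolding e_def using A.idempotents_commute[OF ea(2) eb(2)] A.mult_sinv_of_mult[of a b]
    by (simp_all only: A.idempotents_mult_closed ea eb a[THEN range_idealD] b[THEN range_idealD])
  have ec [simp]: "e \<in> carrier A" using e(1) by (rule idempotentsD)
  have ab: "a \<otimes>\<^bsub>A\<^esub> b \<in> range_ideal (inv\<^bsub>G\<^esub> g)"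
    using range_ideal_ideal[of "inv\<^bsub>G\<^esub> g"] a g by (intro semigroup_ideal_absorb(3)) simp_all
  have we: "w e = w (supp a) \<otimes>\<^bsub>U\<^esub> i e" "w e = w (supp b) \<otimes>\<^bsub>U\<^esub> i e"
  proof -
    have "supp a \<otimes>\<^bsub>A\<^esub> e = e" "supp b \<otimes>\<^bsub>A\<^esub> e = e"
      using A.idempotent_left_absorb[OF ea(2)] A.idempotent_left_absorb[OF eb(2)] e(2) e_def ea(2) eb(2)
      by (metis idempotentsD(1))+
    then show "w e = w (supp a) \<otimes>\<^bsub>U\<^esub> i e" "w e = w (supp b) \<otimes>\<^bsub>U\<^esub> i e"
      using wa(4)[OF e(1)] wb(4)[OF e(1)] by simp_all
  qed
  have comm: "i e \<otimes>\<^bsub>U\<^esub> i a = i a \<otimes>\<^bsub>U\<^esub> i e"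
    using e(1) by (intro idempotent_commutes_i) simp_all
  have ie [simp]: "i e \<in> idempotents U" "i e \<otimes>\<^bsub>U\<^esub> i e = i e" "i e \<in> carrier U"
    using i_idempotent[OF e(1)] by (simp_all only: idempotentsD)
  have "i (conjugate w a \<otimes>\<^bsub>A\<^esub> conjugate w b) = i (conjugate w a) \<otimes>\<^bsub>U\<^esub> i (conjugate w b)"
    using conjugate_closed[OF w g] a b by simp
  also have "\<dots> = w (supp a) \<otimes>\<^bsub>U\<^esub> i a \<otimes>\<^bsub>U\<^esub> (sinv U (w (supp a)) \<otimes>\<^bsub>U\<^esub> w (supp b))
      \<otimes>\<^bsub>U\<^esub> i b \<otimes>\<^bsub>U\<^esub> sinv U (w (supp b))"
    unfolding conjugate_props(1)[OF w g a] conjugate_props(1)[OF w g b]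
    by (simp del: i_mult)
  also have "\<dots> = w (supp a) \<otimes>\<^bsub>U\<^esub> (i a \<otimes>\<^bsub>U\<^esub> i e) \<otimes>\<^bsub>U\<^esub> i b \<otimes>\<^bsub>U\<^esub> sinv U (w (supp b))"
    unfolding section_sinv_mult[OF w g ea(2,1) eb(2,1)] e_def[symmetric]
    by (simp del: i_mult)
  also have "\<dots> = w (supp a) \<otimes>\<^bsub>U\<^esub> i e \<otimes>\<^bsub>U\<^esub> (i e \<otimes>\<^bsub>U\<^esub> i (a \<otimes>\<^bsub>A\<^esub> b)) \<otimes>\<^bsub>U\<^esub> sinv U (w (supp b))"
    unfolding comm[symmetric] by simp
  also have "i e \<otimes>\<^bsub>U\<^esub> i (a \<otimes>\<^bsub>A\<^esub> b) = i (a \<otimes>\<^bsub>A\<^esub> b) \<otimes>\<^bsub>U\<^esub> i e"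
    using e(1) by (intro idempotent_commutes_i) simp_all
  also have "w (supp a) \<otimes>\<^bsub>U\<^esub> i e \<otimes>\<^bsub>U\<^esub> (i (a \<otimes>\<^bsub>A\<^esub> b) \<otimes>\<^bsub>U\<^esub> i e) \<otimes>\<^bsub>U\<^esub> sinv U (w (supp b))
      = w (supp a) \<otimes>\<^bsub>U\<^esub> i e \<otimes>\<^bsub>U\<^esub> i (a \<otimes>\<^bsub>A\<^esub> b) \<otimes>\<^bsub>U\<^esub> sinv U (w (supp b) \<otimes>\<^bsub>U\<^esub> i e)"
    by (simp add: U.sinv_mult)
  also have "\<dots> = w e \<otimes>\<^bsub>U\<^esub> i (a \<otimes>\<^bsub>A\<^esub> b) \<otimes>\<^bsub>U\<^esub> sinv U (w e)"
    unfolding we(1)[symmetric] we(2)[symmetric] ..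
  also have "\<dots> = i (conjugate w (a \<otimes>\<^bsub>A\<^esub> b))"
    unfolding conjugate_props(1)[OF w g ab] e(3) ..
  finally show ?thesis
    using conjugate_closed[OF w g] a b ab by (simp add: i_eq_iff del: i_mult)
qed

text \<open>Sections are indexed by sources, but they also reach every range: if \<open>u\<close>
  over \<open>g\<close> has the given range and source \<open>i e\<close>, then \<open>w e\<close>
  shares the source of \<open>u\<close> and hence its range.\<close>

lemma section_at_range:
  assumes w: "section g w" and g: "g \<in> carrier G" and b: "b \<in> range_ideal g"
  obtains e where "e \<in> idempotents A" "e \<in> range_ideal (inv\<^bsub>G\<^esub> g)"
    "w e \<otimes>\<^bsub>U\<^esub> sinv U (w e) = i (supp b)"
proof -
  obtain u where u: "u \<in> carrier U" "j u = g" "u \<otimes>\<^bsub>U\<^esub> sinv U u = i (supp b)"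
    using b unfolding range_ideal_def by blast
  obtain e where e: "e \<in> idempotents A" "sinv U u \<otimes>\<^bsub>U\<^esub> u = i e"
    using idempotentE[of "sinv U u \<otimes>\<^bsub>U\<^esub> u"] u(1) by auto
  have "e \<in> range_ideal (inv\<^bsub>G\<^esub> g)"
    unfolding range_ideal_inv_iff[OF g] supp_idempotent[OF e(1)]
    using u e(2) idempotentsD(1)[OF e(1)] by blast
  moreover note we = sectionD[OF w e(1) this]
  have "w e \<otimes>\<^bsub>U\<^esub> sinv U (w e) = u \<otimes>\<^bsub>U\<^esub> sinv U u"
    using u e we by (intro range_eq_if_source_eq) simp_all
  ultimately show thesis
    using that e(1) u(3) by simp
qed

text \<open>The support of an image is the range of \<open>w (supp a)\<close>, which determines
  \<open>supp a\<close>. Once the supports agree, conjugating back recovers the element.\<close>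

lemma conjugate_inj_on:
  assumes w: "section g w" and g: "g \<in> carrier G"
  shows "inj_on (conjugate w) (range_ideal (inv\<^bsub>G\<^esub> g))"
proof (rule inj_onI)
  fix a b assume a: "a \<in> range_ideal (inv\<^bsub>G\<^esub> g)" and b: "b \<in> range_ideal (inv\<^bsub>G\<^esub> g)"
    and eq: "conjugate w a = conjugate w b"
  have "w (supp a) \<otimes>\<^bsub>U\<^esub> sinv U (w (supp a)) = w (supp b) \<otimes>\<^bsub>U\<^esub> sinv U (w (supp b))"
    using conjugate_props(3)[OF w g a] conjugate_props(3)[OF w g b] eq by simp
  then have supp: "supp a = supp b"
    by (rule section_range_inj[OF w g supp_in_range_ideal(2,1)[OF a] supp_in_range_ideal(2,1)[OF b]])
  have "i c = sinv U (w (supp c)) \<otimes>\<^bsub>U\<^esub> i (conjugate w c) \<otimes>\<^bsub>U\<^esub> w (supp c)"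
    if c: "c \<in> range_ideal (inv\<^bsub>G\<^esub> g)" for c
  proof -
    note [simp] = range_idealD[OF c]
    note wc = sectionD[OF w supp_in_range_ideal(2,1)[OF c]]
    note [simp] = wc(1)
    have "sinv U (w (supp c)) \<otimes>\<^bsub>U\<^esub> i (conjugate w c) \<otimes>\<^bsub>U\<^esub> w (supp c)
      = (sinv U (w (supp c)) \<otimes>\<^bsub>U\<^esub> w (supp c)) \<otimes>\<^bsub>U\<^esub> i c \<otimes>\<^bsub>U\<^esub> (sinv U (w (supp c)) \<otimes>\<^bsub>U\<^esub> w (supp c))"
      unfolding conjugate_props(1)[OF w g c] by (simp del: i_mult)
    also have "\<dots> = i (supp c \<otimes>\<^bsub>A\<^esub> c \<otimes>\<^bsub>A\<^esub> supp c)"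
      unfolding wc(3) by simp
    also have "supp c \<otimes>\<^bsub>A\<^esub> c \<otimes>\<^bsub>A\<^esub> supp c = c"
      using A.mult_sinv_cancel(1)[of c] A.sinv_mult_comm[of c] by simp
    finally show ?thesis ..
  qed
  from this[OF a] this[OF b] have "i a = i b"
    unfolding eq supp by simp
  then show "a = b"
    using a b by (simp add: i_eq_iff range_idealD)
qed

lemma conjugate_image:
  assumes w: "section g w" and g: "g \<in> carrier G"
  shows "conjugate w ` range_ideal (inv\<^bsub>G\<^esub> g) = range_ideal g"
proof
  show "conjugate w ` range_ideal (inv\<^bsub>G\<^esub> g) \<subseteq> range_ideal g"
    using conjugate_props(2)[OF w g] by blast
  show "range_ideal g \<subseteq> conjugate w ` range_ideal (inv\<^bsub>G\<^esub> g)"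
  proof
    fix b assume b: "b \<in> range_ideal g"
    then have bc [simp]: "b \<in> carrier A" by (rule range_idealD)
    obtain e where e: "e \<in> idempotents A" "e \<in> range_ideal (inv\<^bsub>G\<^esub> g)"
      and range: "w e \<otimes>\<^bsub>U\<^esub> sinv U (w e) = i (supp b)"
      using section_at_range[OF w g b] by blast
    note we = sectionD[OF w e]
    note [simp] = we(1)
    \<comment> \<open>The candidate preimage undoes the conjugation by \<open>w e\<close>. Its
      support must be identified as \<open>e\<close> first, since \<open>conjugate\<close> picks its
      conjugating element by the support.\<close>
    let ?u = "sinv U (w e) \<otimes>\<^bsub>U\<^esub> i b \<otimes>\<^bsub>U\<^esub> w e"
    have bb: "i (supp b) \<otimes>\<^bsub>U\<^esub> i b = i b" "i b \<otimes>\<^bsub>U\<^esub> i (supp b) = i b"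
      using U.mult_sinv_cancel(1)[of "i b"] kernel_sinv_mult_comm[of "i b"] by simp_all
    have "j ?u = \<one>\<^bsub>G\<^esub>" using we(2) g by simp
    then obtain a where a: "a \<in> carrier A" "?u = i a"
      by (metis U.m_closed U.sinv_closed i_closed bc in_kernelE we(1))
    have "i (supp a) = ?u \<otimes>\<^bsub>U\<^esub> sinv U ?u" using a by simp
    also have "\<dots> = sinv U (w e) \<otimes>\<^bsub>U\<^esub> (i b \<otimes>\<^bsub>U\<^esub> (w e \<otimes>\<^bsub>U\<^esub> sinv U (w e)) \<otimes>\<^bsub>U\<^esub> sinv U (i b)) \<otimes>\<^bsub>U\<^esub> w e"
      by (simp add: U.sinv_mult)
    also have "\<dots> = sinv U (w e) \<otimes>\<^bsub>U\<^esub> (w e \<otimes>\<^bsub>U\<^esub> sinv U (w e)) \<otimes>\<^bsub>U\<^esub> w e"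
      unfolding range bb by simp
    also have "\<dots> = i e"
      unfolding we(3)[symmetric] by simp
    finally have supp: "supp a = e"
      using a e(1) by (simp add: i_eq_iff idempotentsD del: i_mult)
    have "a \<in> range_ideal (inv\<^bsub>G\<^esub> g)"
      unfolding range_ideal_inv_iff[OF g] supp using a(1) we by blast
    moreover have "conjugate w a = b"
    proof -
      have "i (conjugate w a) = w e \<otimes>\<^bsub>U\<^esub> ?u \<otimes>\<^bsub>U\<^esub> sinv U (w e)"
        unfolding conjugate_props(1)[OF w g \<open>a \<in> range_ideal (inv\<^bsub>G\<^esub> g)\<close>] supp a(2) ..
      also have "\<dots> = (w e \<otimes>\<^bsub>U\<^esub> sinv U (w e)) \<otimes>\<^bsub>U\<^esub> i b \<otimes>\<^bsub>U\<^esub> (w e \<otimes>\<^bsub>U\<^esub> sinv U (w e))"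
        by simp
      also have "\<dots> = i b" unfolding range bb ..
      finally show ?thesis
        using conjugate_closed[OF w g \<open>a \<in> range_ideal (inv\<^bsub>G\<^esub> g)\<close>] by (simp add: i_eq_iff)
    qed
    ultimately show "b \<in> conjugate w ` range_ideal (inv\<^bsub>G\<^esub> g)" by blast
  qed
qed

lemma dom_conjugation: "dom (conjugation g w) = range_ideal (inv\<^bsub>G\<^esub> g)"
  by (auto simp: conjugation_def split: if_splits)

lemma ran_conjugation:
  assumes "section g w" "g \<in> carrier G"
  shows "ran (conjugation g w) = range_ideal g"
  unfolding conjugate_image[OF assms, symmetric] by (auto simp: conjugation_def ran_def)

lemma the_conjugation:
  "a \<in> range_ideal (inv\<^bsub>G\<^esub> g) \<Longrightarrow> the (conjugation g w a) = conjugate w a"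
  by (simp add: conjugation_def)

lemma conjugation_in_Sigma:
  assumes w: "section g w" and g: "g \<in> carrier G"
  shows "conjugation g w \<in> carrier (Sigma_monoid A)"
proof -
  let ?D = "range_ideal (inv\<^bsub>G\<^esub> g)"
  have ideals: "semigroup_ideal A ?D" "semigroup_ideal A (range_ideal g)"
    using g by (simp_all add: range_ideal_ideal)
  have closed: "a \<otimes>\<^bsub>A\<^esub> b \<in> ?D" if "a \<in> ?D" "b \<in> ?D" for a b
    using that ideals(1) range_idealD by (intro semigroup_ideal_absorb(3)) auto
  have "(\<lambda>s. the (conjugation g w s)) \<in> iso (A\<lparr>carrier := ?D\<rparr>) (A\<lparr>carrier := range_ideal g\<rparr>)"
  proof (rule isoI)
    show "(\<lambda>s. the (conjugation g w s)) \<in> hom (A\<lparr>carrier := ?D\<rparr>) (A\<lparr>carrier := range_ideal g\<rparr>)"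
      using closed conjugate_mult[OF w g] conjugate_props(2)[OF w g]
      by (intro homI) (simp_all add: the_conjugation)
    have "bij_betw (conjugate w) ?D (range_ideal g)"
      using conjugate_inj_on[OF w g] conjugate_image[OF w g] by (simp add: bij_betw_def)
    then show "bij_betw (\<lambda>s. the (conjugation g w s)) (carrier (A\<lparr>carrier := ?D\<rparr>))
        (carrier (A\<lparr>carrier := range_ideal g\<rparr>))"
      by (subst bij_betw_cong[where g = "conjugate w"]) (simp_all add: the_conjugation)
  qed
  then show ?thesis
    using ideals by (simp add: Sigma_monoid_def dom_conjugation ran_conjugation[OF w g])
qed

text \<open>The multiplier relating two sections is \<open>r \<mapsto> w' e (w e)\<^sup>-\<^sup>1\<close>, where \<open>e\<close> is determined by
\<open>r = w e (w e)\<^sup>-\<^sup>1\<close>.\<close>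

lemma sections_compatible_family:
  assumes w: "section g w" and w': "section g w'" and g: "g \<in> carrier G"
  obtains c where "A.compatible_family (range_ideal g) c"
    and "\<And>e r. e \<in> idempotents A \<Longrightarrow> e \<in> range_ideal (inv\<^bsub>G\<^esub> g) \<Longrightarrow> r \<in> idempotents A
      \<Longrightarrow> w e \<otimes>\<^bsub>U\<^esub> sinv U (w e) = i r \<Longrightarrow> i (c r) = w' e \<otimes>\<^bsub>U\<^esub> sinv U (w e)"
proof -
  define lifts where "lifts r e \<longleftrightarrow> e \<in> idempotents A \<and> e \<in> range_ideal (inv\<^bsub>G\<^esub> g) \<and>
    w e \<otimes>\<^bsub>U\<^esub> sinv U (w e) = i r" for r e
  \<comment> \<open>At most one \<open>e\<close> lifts \<open>r\<close>, by
    \<open>section_range_inj\<close>. Where no lift exists the value is arbitrary, but every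
    idempotent of the ideal has one.\<close>
  define c where "c r = (let e = (THE e. lifts r e) in inv_into (carrier A) i (w' e \<otimes>\<^bsub>U\<^esub> sinv U (w e)))" for r
  have lifts_unique: "(THE e. lifts r e) = e" if "lifts r e" for r e
    using that section_range_inj[OF w g] by (intro the_equality) (auto simp: lifts_def)
  have i_c: "i (c r) = w' e \<otimes>\<^bsub>U\<^esub> sinv U (w e)" and c_closed: "c r \<in> carrier A" if "lifts r e" for r e
  proof -
    have e: "e \<in> idempotents A" "e \<in> range_ideal (inv\<^bsub>G\<^esub> g)"
      using that by (simp_all add: lifts_def)
    have "w' e \<otimes>\<^bsub>U\<^esub> sinv U (w e) \<in> carrier U" "j (w' e \<otimes>\<^bsub>U\<^esub> sinv U (w e)) = \<one>\<^bsub>G\<^esub>"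
      using sectionD(1,2)[OF w e] sectionD(1,2)[OF w' e] g by simp_all
    then show "i (c r) = w' e \<otimes>\<^bsub>U\<^esub> sinv U (w e)" "c r \<in> carrier A"
      unfolding c_def lifts_unique[OF that] Let_def by (rule i_inv_into inv_into_closed)+
  qed
  have "A.compatible_family (range_ideal g) c"
    unfolding A.compatible_family_def
  proof (intro ballI conjI)
    fix r assume "r \<in> range_ideal g \<inter> idempotents A"
    then have r: "r \<in> range_ideal g" "r \<in> idempotents A" by blast+
    obtain e where e: "e \<in> idempotents A" "e \<in> range_ideal (inv\<^bsub>G\<^esub> g)"
      and range: "w e \<otimes>\<^bsub>U\<^esub> sinv U (w e) = i r"
      using section_at_range[OF w g r(1)] unfolding supp_idempotent[OF r(2)] by blast
    have lifts: "lifts r e" using e range by (simp add: lifts_def)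
    note we = sectionD[OF w e] and we' = sectionD[OF w' e]
    note [simp] = we(1) we'(1)
    show cr: "c r \<in> carrier A" using lifts by (rule c_closed)
    have "i (supp (c r)) = w' e \<otimes>\<^bsub>U\<^esub> (sinv U (w e) \<otimes>\<^bsub>U\<^esub> w e) \<otimes>\<^bsub>U\<^esub> sinv U (w' e)"
      using cr by (simp add: i_c[OF lifts] U.sinv_mult)
    also have "\<dots> = w' e \<otimes>\<^bsub>U\<^esub> sinv U (w' e)"
      unfolding we(3) section_absorb[OF w' e] ..
    also have "\<dots> = w e \<otimes>\<^bsub>U\<^esub> sinv U (w e)"
      using we we' by (intro range_eq_if_source_eq) simp_all
    finally show "supp (c r) = r"
      using cr idempotentsD(1)[OF r(2)] unfolding range by (simp add: i_eq_iff del: i_mult)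
    fix f assume f: "f \<in> idempotents A"
    note [simp] = idempotentsD(1)[OF f]
    \<comment> \<open>Restricting by \<open>f\<close> at the range is restricting by its conjugate
      \<open>h\<close> at the source: \<open>i f (w e) = (w e) i h\<close>. So \<open>e h\<close> is
      the index belonging to \<open>r f\<close>.\<close>
    obtain h where h: "h \<in> idempotents A" "sinv U (w e) \<otimes>\<^bsub>U\<^esub> (i f \<otimes>\<^bsub>U\<^esub> w e) = i h"
      using f by (metis U.idempotent_conj' i_idempotent idempotentE we(1))
    note [simp] = idempotentsD(1)[OF h(1)]
    have fw: "i f \<otimes>\<^bsub>U\<^esub> w e = w (e \<otimes>\<^bsub>A\<^esub> h)"
      using U.idempotent_mult_eq_mult_conj[of "i f" "w e"] we(4)[OF h(1)] h(2) f by simp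
    have eh: "e \<otimes>\<^bsub>A\<^esub> h \<in> idempotents A" "e \<otimes>\<^bsub>A\<^esub> h \<in> range_ideal (inv\<^bsub>G\<^esub> g)"
      using e h(1) semigroup_ideal_absorb(3)[OF range_ideal_ideal e(2)] g by simp_all
    have "w (e \<otimes>\<^bsub>A\<^esub> h) \<otimes>\<^bsub>U\<^esub> sinv U (w (e \<otimes>\<^bsub>A\<^esub> h)) = i f \<otimes>\<^bsub>U\<^esub> (w e \<otimes>\<^bsub>U\<^esub> sinv U (w e)) \<otimes>\<^bsub>U\<^esub> i f"
      using f unfolding fw[symmetric] by (simp add: U.sinv_mult)
    also have "\<dots> = i (f \<otimes>\<^bsub>A\<^esub> r \<otimes>\<^bsub>A\<^esub> f)"
      unfolding range using idempotentsD(1)[OF r(2)] by simp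
    also have "f \<otimes>\<^bsub>A\<^esub> r \<otimes>\<^bsub>A\<^esub> f = r \<otimes>\<^bsub>A\<^esub> f"
      using A.idempotents_commute[OF f r(2)] f idempotentsD[OF r(2)] idempotentsD[OF f]
      by simp
    finally have lifts_rf: "lifts (r \<otimes>\<^bsub>A\<^esub> f) (e \<otimes>\<^bsub>A\<^esub> h)"
      using eh by (simp add: lifts_def)
    have "i (c (r \<otimes>\<^bsub>A\<^esub> f)) = w' (e \<otimes>\<^bsub>A\<^esub> h) \<otimes>\<^bsub>U\<^esub> sinv U (w (e \<otimes>\<^bsub>A\<^esub> h))"
      using lifts_rf by (rule i_c)
    also have "\<dots> = w' e \<otimes>\<^bsub>U\<^esub> (i h \<otimes>\<^bsub>U\<^esub> sinv U (w e \<otimes>\<^bsub>U\<^esub> i h))"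
      using we(4)[OF h(1)] we'(4)[OF h(1)] by simp
    \<comment> \<open>The factor \<open>i h\<close> coming from \<open>w'\<close> is absorbed by the
      inverse next to it; what remains is turned back into a factor \<open>i f\<close> at the right
      end.\<close>
    also have "i h \<otimes>\<^bsub>U\<^esub> sinv U (w e \<otimes>\<^bsub>U\<^esub> i h) = sinv U (w e \<otimes>\<^bsub>U\<^esub> i h)"
      using h(1) by (simp add: U.sinv_mult)
    also have "w e \<otimes>\<^bsub>U\<^esub> i h = i f \<otimes>\<^bsub>U\<^esub> w e"
      unfolding fw we(4)[OF h(1)] ..
    also have "w' e \<otimes>\<^bsub>U\<^esub> sinv U (i f \<otimes>\<^bsub>U\<^esub> w e) = i (c r \<otimes>\<^bsub>A\<^esub> f)"
      using cr f by (simp add: i_c[OF lifts] U.sinv_mult)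
    finally show "c (r \<otimes>\<^bsub>A\<^esub> f) = c r \<otimes>\<^bsub>A\<^esub> f"
      using cr c_closed[OF lifts_rf] by (simp add: i_eq_iff del: i_mult)
  qed
  then show thesis
    using i_c that by (simp add: lifts_def)
qed

text \<open>Inserting \<open>w^-1 w\<close> on both sides of \<open>i a\<close> shows that
  conjugating by \<open>w'\<close> is conjugating by \<open>w\<close> and then by
  \<open>w' w^-1\<close>, all at the support of \<open>a\<close>. This last element is the value of
  the family \<open>c\<close> at the support of the first conjugate.\<close>

lemma conjugation_cong:
  assumes w: "section g w" and w': "section g w'" and g: "g \<in> carrier G"
  shows "(conjugation g w, conjugation g w') \<in> Sigma_cong A"
proof -
  let ?M = "multiplier_monoid (A\<lparr>carrier := range_ideal g\<rparr>)"
  obtain c where c: "A.compatible_family (range_ideal g) c"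
    and i_c: "\<And>e r. e \<in> idempotents A \<Longrightarrow> e \<in> range_ideal (inv\<^bsub>G\<^esub> g) \<Longrightarrow> r \<in> idempotents A
      \<Longrightarrow> w e \<otimes>\<^bsub>U\<^esub> sinv U (w e) = i r \<Longrightarrow> i (c r) = w' e \<otimes>\<^bsub>U\<^esub> sinv U (w e)"
    using sections_compatible_family[OF assms] by blast
  note ideal = range_ideal_ideal[OF g]
  have "conjugate w' a = two_sided (A.family_multiplier (range_ideal g) c) (conjugate w a)
      (inv\<^bsub>?M\<^esub> (A.family_multiplier (range_ideal g) c))"
    if a: "a \<in> range_ideal (inv\<^bsub>G\<^esub> g)" for a
  proof -
    let ?b = "conjugate w a"
    note e = supp_in_range_ideal(2,1)[OF a]
    note [simp] = range_idealD[OF a] sectionD(1)[OF w e] sectionD(1)[OF w' e]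
    have b: "?b \<in> range_ideal g" "?b \<in> carrier A"
      using conjugate_props(2)[OF w g a] conjugate_closed[OF w g a] .
    have cb: "c (supp ?b) \<in> carrier A"
      using A.compatible_familyD(1)[OF ideal c b(1)] .
    have "i (c (supp ?b)) = w' (supp a) \<otimes>\<^bsub>U\<^esub> sinv U (w (supp a))"
      using b(2) by (intro i_c e conjugate_props(3)[OF w g a, symmetric]) simp
    then have "i (c (supp ?b) \<otimes>\<^bsub>A\<^esub> ?b \<otimes>\<^bsub>A\<^esub> sinv A (c (supp ?b)))
      = w' (supp a) \<otimes>\<^bsub>U\<^esub> sinv U (w (supp a)) \<otimes>\<^bsub>U\<^esub> i ?b \<otimes>\<^bsub>U\<^esub> sinv U (w' (supp a) \<otimes>\<^bsub>U\<^esub> sinv U (w (supp a)))"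
      using b cb by simp
    also have "\<dots> = w' (supp a) \<otimes>\<^bsub>U\<^esub> (sinv U (w (supp a)) \<otimes>\<^bsub>U\<^esub> w (supp a)) \<otimes>\<^bsub>U\<^esub> i a
        \<otimes>\<^bsub>U\<^esub> ((sinv U (w (supp a)) \<otimes>\<^bsub>U\<^esub> w (supp a)) \<otimes>\<^bsub>U\<^esub> sinv U (w' (supp a)))"
      unfolding conjugate_props(1)[OF w g a] by (simp add: U.sinv_mult del: i_mult)
    also have "\<dots> = i (conjugate w' a)"
      unfolding sectionD(3)[OF w e] section_absorb[OF w' e] conjugate_props(1)[OF w' g a] ..
    finally show ?thesis
      unfolding A.two_sided_family_multiplier[OF ideal c b(1)]
      using conjugate_closed[OF w' g a] b(2) cb by (simp add: i_eq_iff del: i_mult)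
  qed
  then show ?thesis
    unfolding Sigma_cong_iff ran_conjugation[OF w g] ran_conjugation[OF w' g] dom_conjugation
    using conjugation_in_Sigma[OF w g] conjugation_in_Sigma[OF w' g]
      A.family_multiplier_unit(1)[OF ideal c] by (auto simp: the_conjugation)
qed

end

section \<open>Sections from refinements and their transport along equivalences\<close>

lemma extension_by_groupD:
  assumes "semilattice_of_groups A" "group G" "extension_by_group A G U i j"
  shows "group_extension A U G i j"
  using assms
  by (simp add: group_extension_def group_extension_axioms_def extension_by_group_def)

text \<open>The section sends \<open>e\<close> to \<rho>(s) for the unique \<open>s\<close> over
  \<open>g\<close> with source \<pi>(i e). Uniqueness rests on \<kappa>^-1(1) = E(S), compatibility
  with restriction on the monotonicity of \<rho>.\<close>

lemma kernel_iso_eq_conjugation: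
  assumes A: "semilattice_of_groups A" and G: "group G" and ext: "extension_by_group A G U i j"
    and ref: "refinement A G U i j S \<pi> \<kappa>" and \<rho>: "order_preserving_transversal U S \<pi> \<rho>"
    and g: "g \<in> carrier G"
  shows "\<exists>w. group_extension.section A U G i j g w \<and>
    kernel_iso A G U i S \<kappa> \<rho> g = group_extension.conjugation A U G i j g w"
proof -
  interpret group_extension A U G i j
    using A G ext by (rule extension_by_groupD)
  from ref interpret S: inverse_semigroup S
    by (simp add: refinement_def extension_by_inverse_semigroup_def)
  have \<pi>: "\<pi> \<in> hom U S" "\<pi> ` carrier U = carrier S" "inj_on \<pi> (idempotents U)"
    and \<kappa>: "\<kappa> \<in> hom S G" and ker_\<pi>: "i ` carrier A = {u \<in> carrier U. \<pi> u \<in> idempotents S}"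
    and j_eq: "\<And>u. u \<in> carrier U \<Longrightarrow> \<kappa> (\<pi> u) = j u"
    using ref by (auto simp: refinement_def extension_by_inverse_semigroup_def epi_def)
  have \<rho>_closed [simp]: "\<rho> s \<in> carrier U" and \<pi>_\<rho> [simp]: "\<pi> (\<rho> s) = s" if "s \<in> carrier S" for s
    using \<rho> that by (auto simp: order_preserving_transversal_def)
  have \<rho>_idem: "\<rho> s \<in> idempotents U" if "s \<in> idempotents S" for s
    using \<rho> that by (auto simp: order_preserving_transversal_def)
  have \<rho>_mono: "natural_le U (\<rho> s) (\<rho> t)" if "s \<in> carrier S" "t \<in> carrier S" "natural_le S s t" for s t
    using \<rho> that by (auto simp: order_preserving_transversal_def)
  have [simp]: "\<pi> u \<in> carrier S" if "u \<in> carrier U" for u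
    using \<pi>(1) that by (rule hom_in_carrier)
  have \<pi>_mult: "\<pi> (u \<otimes>\<^bsub>U\<^esub> v) = \<pi> u \<otimes>\<^bsub>S\<^esub> \<pi> v" if "u \<in> carrier U" "v \<in> carrier U" for u v
    using hom_mult[OF \<pi>(1) that] .
  have \<pi>_sinv: "\<pi> (sinv U u) = sinv S (\<pi> u)" if "u \<in> carrier U" for u
    using U.hom_sinv[OF S.inverse_semigroup_axioms \<pi>(1) that] .
  have \<kappa>_mult: "\<kappa> (s \<otimes>\<^bsub>S\<^esub> t) = \<kappa> s \<otimes>\<^bsub>G\<^esub> \<kappa> t" if "s \<in> carrier S" "t \<in> carrier S" for s t
    using hom_mult[OF \<kappa> that] .
  have \<kappa>_sinv: "\<kappa> (sinv S s) = inv\<^bsub>G\<^esub> (\<kappa> s)" if "s \<in> carrier S" for s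
    using S.group_hom_sinv[OF G \<kappa> that] .
  \<comment> \<open>On idempotents \<rho> inverts \<pi>, so conditions on \<rho> of a source or
    range become equations in \<open>S\<close>.\<close>
  have \<rho>_idem_iff: "\<rho> s = u \<longleftrightarrow> s = \<pi> u" if "s \<in> idempotents S" "u \<in> idempotents U" for s u
    using that \<rho>_idem[OF that(1)] inj_onD[OF \<pi>(3), of "\<rho> s" u] idempotentsD(1)[OF that(1)] by auto
  have i_supp: "i (supp a) \<in> idempotents U" if "a \<in> carrier A" for a
    using that by (simp del: i_mult)

  have dom: "kernel_dom A U i S \<kappa> \<rho> h = range_ideal h" for h
  proof -
    have "(\<exists>s \<in> carrier S. \<kappa> s = h \<and> \<rho> (s \<otimes>\<^bsub>S\<^esub> sinv S s) = i (supp a)) \<longleftrightarrow>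
        (\<exists>u \<in> carrier U. j u = h \<and> u \<otimes>\<^bsub>U\<^esub> sinv U u = i (supp a))" if a: "a \<in> carrier A" for a
    proof -
      have eq: "\<pi> (u \<otimes>\<^bsub>U\<^esub> sinv U u) = \<pi> (i (supp a)) \<longleftrightarrow> u \<otimes>\<^bsub>U\<^esub> sinv U u = i (supp a)"
        if "u \<in> carrier U" for u
        using inj_on_eq_iff[OF \<pi>(3), of "u \<otimes>\<^bsub>U\<^esub> sinv U u" "i (supp a)"] that i_supp[OF a]
        by simp
      \<comment> \<open>Since \<pi> is onto, \<open>s\<close> may be taken as \<pi>(u); injectivity
        of \<pi> on idempotents then removes \<pi> from the equation.\<close>
      have "(\<exists>s \<in> \<pi> ` carrier U. \<kappa> s = h \<and> s \<otimes>\<^bsub>S\<^esub> sinv S s = \<pi> (i (supp a))) \<longleftrightarrow>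
        (\<exists>u \<in> carrier U. j u = h \<and> u \<otimes>\<^bsub>U\<^esub> sinv U u = i (supp a))"
        unfolding bex_simps(7) using j_eq eq \<pi>_mult \<pi>_sinv by (intro bex_cong) auto
      then show ?thesis
        unfolding \<pi>(2) using \<rho>_idem_iff i_supp[OF a] by (metis S.idempotent_sinv_mult(2))
    qed
    then show ?thesis unfolding kernel_dom_def range_ideal_def by blast
  qed

  define lifts where "lifts e s \<longleftrightarrow> s \<in> carrier S \<and> \<kappa> s = g \<and> \<rho> (sinv S s \<otimes>\<^bsub>S\<^esub> s) = i e" for e s
  define w where "w e = \<rho> (THE s. lifts e s)" for e
  have lifts_iff: "lifts e s \<longleftrightarrow> s \<in> carrier S \<and> \<kappa> s = g \<and> sinv S s \<otimes>\<^bsub>S\<^esub> s = \<pi> (i e)"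
    if "e \<in> idempotents A" for e s
    unfolding lifts_def using \<rho>_idem_iff[of "sinv S s \<otimes>\<^bsub>S\<^esub> s" "i e"]
    using that by (metis S.idempotent_sinv_mult(1) i_idempotent)
  have w_eq: "w e = \<rho> s" if e: "e \<in> idempotents A" and s: "lifts e s" for e s
  proof -
    have "t = s" if t: "lifts e t" for t
    proof -
      have st [simp]: "s \<in> carrier S" "t \<in> carrier S" and eq: "sinv S s \<otimes>\<^bsub>S\<^esub> s = sinv S t \<otimes>\<^bsub>S\<^esub> t"
        using s t lifts_iff[OF e] by simp_all
      \<comment> \<open>The quotient of two lifts lies over the unit, so it is the image of an
        element of \<open>i(A)\<close> and hence idempotent. This puts \<open>s\<close> below
        \<open>t\<close>, and comparable elements with equal sources coincide.\<close>
      have "\<kappa> (s \<otimes>\<^bsub>S\<^esub> sinv S t) = \<one>\<^bsub>G\<^esub>"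
        using s t g by (simp add: lifts_def \<kappa>_mult \<kappa>_sinv)
      moreover obtain u where u: "u \<in> carrier U" "\<pi> u = s \<otimes>\<^bsub>S\<^esub> sinv S t"
        using \<pi>(2) st S.m_closed S.sinv_closed by (metis imageE)
      ultimately have "u \<in> i ` carrier A"
        using j_eq[OF u(1)] u kernel by simp
      then have "s \<otimes>\<^bsub>S\<^esub> sinv S t \<in> idempotents S"
        using ker_\<pi> u(2) by auto
      moreover have "s = s \<otimes>\<^bsub>S\<^esub> sinv S t \<otimes>\<^bsub>S\<^esub> t"
        using eq by (simp flip: eq)
      ultimately have "natural_le S s t"
        unfolding natural_le_def by blast
      then have "s = t \<otimes>\<^bsub>S\<^esub> (sinv S s \<otimes>\<^bsub>S\<^esub> s)"
        by (simp only: S.natural_le_iff_restrict st)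
      then show "t = s" unfolding eq by simp
    qed
    then have "(THE s. lifts e s) = s" using s by (intro the_equality)
    then show ?thesis by (simp add: w_def)
  qed

  have "section g w"
    unfolding section_def
  proof (intro ballI conjI)
    fix e assume "e \<in> idempotents A \<inter> range_ideal (inv\<^bsub>G\<^esub> g)"
    then have e: "e \<in> idempotents A" "e \<in> range_ideal (inv\<^bsub>G\<^esub> g)" by blast+
    note ec = idempotentsD(1)[OF e(1)]
    obtain u where u: "u \<in> carrier U" "j u = g" "sinv U u \<otimes>\<^bsub>U\<^esub> u = i e"
      using e(2) unfolding range_ideal_inv_iff[OF g] supp_idempotent[OF e(1)] by blast
    define s where "s = \<pi> u"
    have s: "s \<in> carrier S" "\<kappa> s = g" "sinv S s \<otimes>\<^bsub>S\<^esub> s = \<pi> (i e)"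
      unfolding s_def u(3)[symmetric] using u(1,2) by (simp_all add: j_eq \<pi>_mult \<pi>_sinv)
    have we: "w e = \<rho> s"
      using e(1) s by (intro w_eq) (simp_all add: lifts_iff)
    have source: "sinv U (\<rho> t) \<otimes>\<^bsub>U\<^esub> \<rho> t = i f"
      if "t \<in> carrier S" "sinv S t \<otimes>\<^bsub>S\<^esub> t = \<pi> (i f)" "f \<in> idempotents A" for t f
      using that by (intro inj_onD[OF \<pi>(3)]) (simp_all add: \<pi>_mult \<pi>_sinv)
    show "w e \<in> carrier U" "j (w e) = g" "sinv U (w e) \<otimes>\<^bsub>U\<^esub> w e = i e"
      unfolding we using s source[OF s(1,3) e(1)] by (simp_all flip: j_eq)
    fix f assume f: "f \<in> idempotents A"
    note fc = idempotentsD(1)[OF f]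
    \<comment> \<open>This is \<open>s\<close> restricted to the smaller source, hence the lift of
      \<open>e f\<close>, and it lies below \<open>s\<close>. Monotonicity of \<rho> carries the
      relation to \<open>U\<close>, where it says that \<rho>(t) is \<rho>(s) times
      \<open>i (e f)\<close>.\<close>
    define t where "t = s \<otimes>\<^bsub>S\<^esub> \<pi> (i f)"
    have \<pi>f: "\<pi> (i f) \<in> idempotents S" "\<pi> (i f) \<in> carrier S" "\<pi> (i e) \<in> carrier S"
      using idempotents_hom[OF \<pi>(1) i_idempotent[OF f]] ec fc by simp_all
    have tc: "t \<in> carrier S" using s(1) \<pi>f by (simp add: t_def)
    have "sinv S t \<otimes>\<^bsub>S\<^esub> t = \<pi> (i f) \<otimes>\<^bsub>S\<^esub> (sinv S s \<otimes>\<^bsub>S\<^esub> s) \<otimes>\<^bsub>S\<^esub> \<pi> (i f)"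
      using s(1) \<pi>f by (simp add: t_def S.sinv_mult)
    also have "\<dots> = \<pi> (i (f \<otimes>\<^bsub>A\<^esub> e \<otimes>\<^bsub>A\<^esub> f))"
      unfolding s(3) using ec fc by (simp add: \<pi>_mult)
    also have "f \<otimes>\<^bsub>A\<^esub> e \<otimes>\<^bsub>A\<^esub> f = e \<otimes>\<^bsub>A\<^esub> f"
      using A.idempotents_commute[OF f e(1)] ec idempotentsD[OF f] by simp
    finally have t_source: "sinv S t \<otimes>\<^bsub>S\<^esub> t = \<pi> (i (e \<otimes>\<^bsub>A\<^esub> f))" .
    have ef: "e \<otimes>\<^bsub>A\<^esub> f \<in> idempotents A" using e(1) f by simp
    have "\<kappa> t = g"
      using s(1,2) g \<pi>f fc by (simp add: t_def \<kappa>_mult j_eq)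
    then have wef: "w (e \<otimes>\<^bsub>A\<^esub> f) = \<rho> t"
      using tc t_source by (intro w_eq[OF ef]) (simp add: lifts_iff[OF ef])
    have "t = s \<otimes>\<^bsub>S\<^esub> (sinv S t \<otimes>\<^bsub>S\<^esub> t)"
    proof -
      have "s \<otimes>\<^bsub>S\<^esub> (sinv S t \<otimes>\<^bsub>S\<^esub> t) = s \<otimes>\<^bsub>S\<^esub> \<pi> (i e) \<otimes>\<^bsub>S\<^esub> \<pi> (i f)"
        unfolding t_source using s(1) ec fc \<pi>f by (simp add: \<pi>_mult)
      then show ?thesis
        using s(1) by (simp add: t_def flip: s(3))
    qed
    then have "natural_le U (\<rho> t) (\<rho> s)"
      using tc s(1) by (intro \<rho>_mono) (simp_all only: S.natural_le_iff_restrict)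
    then have "\<rho> t = \<rho> s \<otimes>\<^bsub>U\<^esub> (sinv U (\<rho> t) \<otimes>\<^bsub>U\<^esub> \<rho> t)"
      using tc s(1) by (simp only: U.natural_le_iff_restrict \<rho>_closed)
    also have "\<dots> = \<rho> s \<otimes>\<^bsub>U\<^esub> i e \<otimes>\<^bsub>U\<^esub> i f"
      unfolding source[OF tc t_source ef] using s(1) ec fc by simp
    also have "\<rho> s \<otimes>\<^bsub>U\<^esub> i e = \<rho> s"
      using s(1) by (simp flip: source[OF s(1,3) e(1)])
    finally show "w (e \<otimes>\<^bsub>A\<^esub> f) = w e \<otimes>\<^bsub>U\<^esub> i f"
      unfolding we wef .
  qed
  \<comment> \<open>Both sides contain the same description of \<open>s\<close>, taken at the
    support of \<open>a\<close>, so they agree by unfolding.\<close>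
  moreover have "kernel_iso A G U i S \<kappa> \<rho> g = conjugation g w"
    unfolding kernel_iso_def conjugation_def dom conjugate_def w_def lifts_def Let_def ..
  ultimately show ?thesis by blast
qed

text \<open>As \<mu> respects products, inverses and the maps to \<open>G\<close>, both extensions
  have the same ideals in \<open>A\<close>. The conjugations agree as partial maps, not only up to a
  multiplier, because \<open>i'\<close> extends \<open>i\<close> by \<mu> and so cancels it.\<close>

lemma conjugation_transport:
  assumes "group_extension A U G i j" and "group_extension A U' G i' j'"
    and \<mu>: "\<mu> \<in> iso U U'" "\<And>a. a \<in> carrier A \<Longrightarrow> \<mu> (i a) = i' a" "\<And>u. u \<in> carrier U \<Longrightarrow> j' (\<mu> u) = j u"
    and g: "g \<in> carrier G" and w: "group_extension.section A U G i j g w"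
  shows "group_extension.section A U' G i' j' g (\<lambda>e. \<mu> (w e))"
    and "group_extension.conjugation A U' G i' j' g (\<lambda>e. \<mu> (w e))
      = group_extension.conjugation A U G i j g w"
proof -
  interpret E: group_extension A U G i j by fact
  interpret E': group_extension A U' G i' j' by fact
  have \<mu>_hom: "\<mu> \<in> hom U U'" and \<mu>_bij: "bij_betw \<mu> (carrier U) (carrier U')"
    using \<mu>(1) by (simp_all add: iso_def)
  have \<mu>_closed [simp]: "\<mu> u \<in> carrier U'" if "u \<in> carrier U" for u
    using \<mu>_hom that by (rule hom_in_carrier)
  have \<mu>_mult: "\<mu> (u \<otimes>\<^bsub>U\<^esub> v) = \<mu> u \<otimes>\<^bsub>U'\<^esub> \<mu> v" if "u \<in> carrier U" "v \<in> carrier U" for u v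
    using hom_mult[OF \<mu>_hom that] .
  have \<mu>_sinv: "\<mu> (sinv U u) = sinv U' (\<mu> u)" if "u \<in> carrier U" for u
    using E.U.hom_sinv[OF E'.U.inverse_semigroup_axioms \<mu>_hom that] .
  have \<mu>_eq_iff: "\<mu> u = \<mu> v \<longleftrightarrow> u = v" if "u \<in> carrier U" "v \<in> carrier U" for u v
    using \<mu>_bij that by (auto simp: bij_betw_def inj_on_def)
  have ideals: "E'.range_ideal h = E.range_ideal h" for h
  proof -
    have "(\<exists>v \<in> \<mu> ` carrier U. j' v = h \<and> v \<otimes>\<^bsub>U'\<^esub> sinv U' v = i' (E.supp a)) \<longleftrightarrow>
        (\<exists>u \<in> carrier U. j u = h \<and> u \<otimes>\<^bsub>U\<^esub> sinv U u = i (E.supp a))" if "a \<in> carrier A" for a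
      unfolding bex_simps(7) using that
      by (intro bex_cong) (simp_all del: E.i_mult E'.i_mult add: \<mu>(3) flip: \<mu>(2) \<mu>_mult \<mu>_sinv \<mu>_eq_iff)
    moreover have "\<mu> ` carrier U = carrier U'"
      using \<mu>_bij by (simp add: bij_betw_def)
    ultimately show ?thesis
      unfolding E.range_ideal_def E'.range_ideal_def
      by (intro Collect_cong conj_cong) (simp_all only:)
  qed
  show "E'.section g (\<lambda>e. \<mu> (w e))"
    unfolding E'.section_def ideals
  proof (intro ballI conjI)
    fix e assume "e \<in> idempotents A \<inter> E.range_ideal (inv\<^bsub>G\<^esub> g)"
    then have e: "e \<in> idempotents A" "e \<in> E.range_ideal (inv\<^bsub>G\<^esub> g)" by blast+
    note we = E.sectionD[OF w e]
    show "\<mu> (w e) \<in> carrier U'" "j' (\<mu> (w e)) = g" using we \<mu>(3) by simp_all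
    show "sinv U' (\<mu> (w e)) \<otimes>\<^bsub>U'\<^esub> \<mu> (w e) = i' e"
      using we idempotentsD(1)[OF e(1)] by (simp flip: \<mu>(2) \<mu>_mult \<mu>_sinv)
    show "\<mu> (w (e \<otimes>\<^bsub>A\<^esub> f)) = \<mu> (w e) \<otimes>\<^bsub>U'\<^esub> i' f" if "f \<in> idempotents A" for f
      using we(1) we(4)[OF that] idempotentsD(1)[OF that] by (simp add: \<mu>_mult \<mu>(2))
  qed
  have "E'.conjugate (\<lambda>e. \<mu> (w e)) a = E.conjugate w a" if a: "a \<in> E.range_ideal (inv\<^bsub>G\<^esub> g)" for a
  proof -
    note wa = E.sectionD(1)[OF w E.supp_in_range_ideal(2,1)[OF a]]
    have "\<mu> (w (E.supp a)) \<otimes>\<^bsub>U'\<^esub> i' a \<otimes>\<^bsub>U'\<^esub> sinv U' (\<mu> (w (E.supp a))) = i' (E.conjugate w a)"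
      using wa E.range_idealD[OF a] E.conjugate_closed[OF w g a] E.conjugate_props(1)[OF w g a]
      by (simp flip: \<mu>(2) add: \<mu>_mult \<mu>_sinv)
    then show ?thesis
      unfolding E'.conjugate_def using E.conjugate_closed[OF w g a] by simp
  qed
  then show "E'.conjugation g (\<lambda>e. \<mu> (w e)) = E.conjugation g w"
    unfolding E.conjugation_def E'.conjugation_def ideals by auto
qed

text \<open>The partial map from \<open>U\<close> reappears unchanged as a conjugation in
  \<open>U'\<close>, and is compared there with the one from the second transversal. Multipliers
  thus enter only within a single extension, and \<open>S\<close> and \<open>S'\<close> are never
  compared directly.\<close>

lemma kernel_map_eq:
  assumes A: "semilattice_of_groups A" and G: "group G"
    and ext: "extension_by_group A G U i j" and ext': "extension_by_group A G U' i' j'"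
    and equiv: "equivalent_extensions A U i j U' i' j'"
    and ref: "refinement A G U i j S \<pi> \<kappa>" "order_preserving_transversal U S \<pi> \<rho>"
    and ref': "refinement A G U' i' j' S' \<pi>' \<kappa>'" "order_preserving_transversal U' S' \<pi>' \<rho>'"
  shows "kernel_map A G U i S \<kappa> \<rho> = kernel_map A G U' i' S' \<kappa>' \<rho>'"
proof -
  obtain \<mu> where \<mu>: "\<mu> \<in> iso U U'" "\<And>a. a \<in> carrier A \<Longrightarrow> \<mu> (i a) = i' a"
      "\<And>u. u \<in> carrier U \<Longrightarrow> j' (\<mu> u) = j u"
    using equiv unfolding equivalent_extensions_def by blast
  have E: "group_extension A U G i j" and E': "group_extension A U' G i' j'"
    using A G ext ext' by (simp_all add: extension_by_groupD)
  interpret A: semilattice_of_groups A by fact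
  have "(kernel_iso A G U i S \<kappa> \<rho> g, kernel_iso A G U' i' S' \<kappa>' \<rho>' g) \<in> Sigma_cong A"
    if g: "g \<in> carrier G" for g
    using kernel_iso_eq_conjugation[OF A G ext ref g] kernel_iso_eq_conjugation[OF A G ext' ref' g]
      conjugation_transport[OF E E' \<mu> g] group_extension.conjugation_cong[OF E' _ _ g] by metis
  then show ?thesis
    unfolding kernel_map_def by (intro restrict_ext A.Sigma_cong_class_eq)
qed

theorem proposition2p3:
  fixes A :: "'a monoid" and G :: "'g monoid"
    and U :: "'u monoid" and i :: "'a \<Rightarrow> 'u" and j :: "'u \<Rightarrow> 'g"
    and U' :: "'v monoid" and i' :: "'a \<Rightarrow> 'v" and j' :: "'v \<Rightarrow> 'g"
  assumes "semilattice_of_groups A" and "group G"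
    and "admissible TYPE('s) A G U i j" and "admissible TYPE('t) A G U' i' j'"
    and "equivalent_extensions A U i j U' i' j'"
  shows "\<exists>\<psi>. is_abstract_kernel TYPE('s) A G U i j \<psi> \<and> is_abstract_kernel TYPE('t) A G U' i' j' \<psi>"
proof -
  from assms(3,4) have ext: "extension_by_group A G U i j" "extension_by_group A G U' i' j'"
    by (simp_all add: admissible_def)
  obtain S :: "'s monoid" and \<pi> \<kappa> \<rho>
    where S: "refinement A G U i j S \<pi> \<kappa>" "order_preserving_transversal U S \<pi> \<rho>"
    using assms(3) unfolding admissible_def by blast
  obtain S' :: "'t monoid" and \<pi>' \<kappa>' \<rho>'
    where S': "refinement A G U' i' j' S' \<pi>' \<kappa>'" "order_preserving_transversal U' S' \<pi>' \<rho>'"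
    using assms(4) unfolding admissible_def by blast
  note eq = kernel_map_eq[OF assms(1,2) ext assms(5)]
  have "kernel_iso A G U i S \<kappa> \<rho> g \<in> carrier (Sigma_monoid A)" if "g \<in> carrier G" for g
    using kernel_iso_eq_conjugation[OF assms(1,2) ext(1) S that]
      group_extension.conjugation_in_Sigma[OF extension_by_groupD[OF assms(1,2) ext(1)] _ that]
    by auto
  then have "kernel_map A G U i S \<kappa> \<rho> \<in> carrier G \<rightarrow>\<^sub>E carrier (varsigma_monoid A)"
    by (auto simp: kernel_map_def varsigma_monoid_def intro!: quotientI)
  then have "is_abstract_kernel TYPE('s) A G U i j (kernel_map A G U i S \<kappa> \<rho>)"
    "is_abstract_kernel TYPE('t) A G U' i' j' (kernel_map A G U i S \<kappa> \<rho>)"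
    \<comment> \<open>Any other refinement of the first extension is compared with \<open>S\<close>
      through \<open>S'\<close>; any refinement of the second is compared with \<open>S\<close>
      directly.\<close>
    unfolding is_abstract_kernel_def using eq[OF S S'] eq[OF _ _ S', symmetric] eq[OF S] by auto
  then show ?thesis by blast
qed

end
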